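(* Let $\varphi:\mathbb{R}^n\to\overline{\mathbb{R}}$ be finite at $\bar x\in\mathbb{R}^n$ and have the composite representation $\varphi=g\circ\Phi$ around $\bar x$. Let $\bar v\in\partial\varphi(\bar x)$ and assume that the second-order qualification condition (SOQC) holds at $(\bar x,\bar\lambda)$, where $\bar\lambda$ is the unique vector in $\Lambda(\bar x,\bar v)$. Suppose further that $\varphi$ is prox-bounded. Then the following properties are equivalent: (a) there exists a positive constant $\rho$ such that for any $r\in(0,1/\rho)$, the proximal mapping $\mathrm{prox}_{r\varphi}$ is $\mathcal{C}^1$ in a neighborhood of $\bar x+r\bar v$; (b) there exists a positive constant $\rho$ such that for any $r\in(0,1/\rho)$, the envelope function $e_r\varphi$ is $\mathcal{C}^2$ in a neighborhood of $\bar x+r\bar v$; (c) $\bar v\in\mathrm{ri}\,\partial\varphi(\bar x)$.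
   Context: $\overline{\mathbb{R}}=[-\infty,\infty]$; $\mathrm{ri}$ denotes relative interior. "$\varphi$ has the composite representation around $\bar x$" means: there are a neighborhood $O$ of $\bar x$, a mapping $\Phi:\mathbb{R}^n\to\mathbb{R}^m$ twice continuously differentiable around $\bar x$, and a polyhedral function $g:\mathbb{R}^m\to\overline{\mathbb{R}}$ (proper, with $\mathrm{epi}\,g$ a polyhedral convex set) such that $\varphi(x)=g(\Phi(x))$ for all $x\in O$. $\nabla\Phi(x)$ is the Jacobian and $\nabla\Phi(x)^*$ its transpose. Tangent cone: $T_\Omega(\bar x)=\limsup_{t\searrow0}(\Omega-\bar x)/t$. Regular normal cone: $\widehat N_\Omega(\bar x)=T_\Omega(\bar x)^*$ (polar cone). Limiting normal cone $N_\Omega(\bar x)$: all limits of $v^k\in\widehat N_\Omega(x^k)$ with $x^k\to\bar x$, $x^k\in\Omega$. Subdifferential: $\partial f(\bar x)=\{v : (v,-1)\in N_{\mathrm{epi} f}(\bar x,f(\bar x))\}$. Coderivative of $F$: $w\in D^*F(\bar x,\bar y)(u)\iff(w,-u)\in N_{\mathrm{gph}F}(\bar x,\bar y)$. Multipliers: $\Lambda(x,v)=\{\lambda\in\mathbb{R}^m : \nabla\Phi(x)^*\lambda=v,\ \lambda\in\partial g(\Phi(x))\}$. SOQC at $(\bar x,\bar\lambda)$: $D^*(\partial g)(\Phi(\bar x),\bar\lambda)(0)\cap\ker\nabla\Phi(\bar x)^*=\{0\}$. For $r>0$: $\mathrm{prox}_{r\varphi}(x)=\operatorname{argmin}_{w\in\mathbb{R}^n}\{\varphi(w)+\frac1{2r}\|w-x\|^2\}$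 (set-valued in general; being $\mathcal{C}^1$ in a neighborhood includes being single-valued there) and $e_r\varphi(x)=\inf_{w\in\mathbb{R}^n}\{\varphi(w)+\frac1{2r}\|w-x\|^2\}$ (Moreau envelope). $\varphi$ is prox-bounded if for some $\alpha\in\mathbb{R}$ the function $\varphi+\alpha\|\cdot\|^2$ is bounded from below on $\mathbb{R}^n$. *)

theory Defs
  imports "HOL-Analysis.Analysis"
begin

definition C1_on :: "'a::real_normed_vector set \<Rightarrow> ('a \<Rightarrow> 'b::real_normed_vector) \<Rightarrow> bool" where
  "C1_on U f \<longleftrightarrow>
     (\<exists>D :: 'a \<Rightarrow> ('a \<Rightarrow>\<^sub>L 'b).
        (\<forall>y\<in>U. (f has_derivative blinfun_apply (D y)) (at y)) \<and> continuous_on U D)"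

definition C2_on :: "'a::real_normed_vector set \<Rightarrow> ('a \<Rightarrow> 'b::real_normed_vector) \<Rightarrow> bool" where
  "C2_on U f \<longleftrightarrow>
     (\<exists>D :: 'a \<Rightarrow> ('a \<Rightarrow>\<^sub>L 'b).
        (\<forall>y\<in>U. (f has_derivative blinfun_apply (D y)) (at y)) \<and> C1_on U D)"

definition C1_around :: "('a::real_normed_vector \<Rightarrow> 'b::real_normed_vector) \<Rightarrow> 'a \<Rightarrow> bool" where
  "C1_around f x \<longleftrightarrow> (\<exists>U. open U \<and> x \<in> U \<and> C1_on U f)"

definition C2_around :: "('a::real_normed_vector \<Rightarrow> 'b::real_normed_vector) \<Rightarrow> 'a \<Rightarrow> bool" where
  "C2_around f x \<longleftrightarrow> (\<exists>U. open U \<and> x \<in> U \<and> C2_on U f)"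

text \<open>A set-valued mapping (an extended-real-valued function) is smooth around a point when, on a
  neighbourhood of that point, it is single-valued (finite) and given by a smooth function.\<close>

definition set_valued_C1_around ::
  "('a::real_normed_vector \<Rightarrow> 'b::real_normed_vector set) \<Rightarrow> 'a \<Rightarrow> bool" where
  "set_valued_C1_around F x \<longleftrightarrow>
     (\<exists>p. (\<forall>\<^sub>F y in nhds x. F y = {p y}) \<and> C1_around p x)"

definition ereal_C2_around :: "('a::real_normed_vector \<Rightarrow> ereal) \<Rightarrow> 'a \<Rightarrow> bool" where
  "ereal_C2_around f x \<longleftrightarrow>
     (\<exists>e. (\<forall>\<^sub>F y in nhds x. f y = ereal (e y)) \<and> C2_around e x)"

definition tangent_cone :: "'a::real_inner set \<Rightarrow> 'a \<Rightarrow> 'a set" where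
  "tangent_cone S x =
     {w. \<exists>(t :: nat \<Rightarrow> real) u. (\<forall>k. 0 < t k) \<and> t \<longlonglongrightarrow> 0 \<and> u \<longlonglongrightarrow> w \<and>
           (\<forall>k. x + t k *\<^sub>R u k \<in> S)}"

definition polar_cone :: "'a::real_inner set \<Rightarrow> 'a set" where
  "polar_cone K = {v. \<forall>w\<in>K. v \<bullet> w \<le> 0}"

definition regular_normal_cone :: "'a::real_inner set \<Rightarrow> 'a \<Rightarrow> 'a set" where
  "regular_normal_cone S x = polar_cone (tangent_cone S x)"

definition normal_cone :: "'a::real_inner set \<Rightarrow> 'a \<Rightarrow> 'a set" where
  "normal_cone S x =
     {v. \<exists>(y :: nat \<Rightarrow> 'a) u. (\<forall>k. y k \<in> S \<and> u k \<in> regular_normal_cone S (y k)) \<and>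
           y \<longlonglongrightarrow> x \<and> u \<longlonglongrightarrow> v}"

definition epi :: "('a \<Rightarrow> ereal) \<Rightarrow> ('a \<times> real) set" where
  "epi f = {(x, \<alpha>). f x \<le> ereal \<alpha>}"

definition gph :: "('a \<Rightarrow> 'b set) \<Rightarrow> ('a \<times> 'b) set" where
  "gph F = {(x, y). y \<in> F x}"

text \<open>By convention the subdifferential is empty where the function is not finite.\<close>

definition subdifferential :: "('a::real_inner \<Rightarrow> ereal) \<Rightarrow> 'a \<Rightarrow> 'a set" where
  "subdifferential f x =
     {v. \<bar>f x\<bar> \<noteq> \<infinity> \<and> (v, -1) \<in> normal_cone (epi f) (x, real_of_ereal (f x))}"

definition coderivative ::
  "('a::real_inner \<Rightarrow> 'b::real_inner set) \<Rightarrow> 'a \<Rightarrow> 'b \<Rightarrow> 'b \<Rightarrow> 'a set" where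
  "coderivative F x y u = {w. (w, - u) \<in> normal_cone (gph F) (x, y)}"

definition proper_fun :: "('a \<Rightarrow> ereal) \<Rightarrow> bool" where
  "proper_fun f \<longleftrightarrow> (\<forall>x. f x \<noteq> -\<infinity>) \<and> (\<exists>x. f x \<noteq> \<infinity>)"

definition polyhedral_fun :: "('a::euclidean_space \<Rightarrow> ereal) \<Rightarrow> bool" where
  "polyhedral_fun g \<longleftrightarrow> proper_fun g \<and> polyhedron (epi g)"

definition composite_representation ::
  "(real^'n \<Rightarrow> ereal) \<Rightarrow> (real^'m \<Rightarrow> ereal) \<Rightarrow> (real^'n \<Rightarrow> real^'m) \<Rightarrow> real^'n \<Rightarrow> bool" where
  "composite_representation \<phi> g \<Phi> x \<longleftrightarrow>
     polyhedral_fun g \<and> C2_around \<Phi> x \<and> (\<forall>\<^sub>F y in nhds x. \<phi> y = g (\<Phi> y))"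

definition multipliers ::
  "(real^'m \<Rightarrow> ereal) \<Rightarrow> (real^'n \<Rightarrow> real^'m) \<Rightarrow> real^'n \<Rightarrow> real^'n \<Rightarrow> (real^'m) set" where
  "multipliers g \<Phi> x v =
     {l. transpose (jacobian \<Phi> (at x)) *v l = v \<and> l \<in> subdifferential g (\<Phi> x)}"

definition SOQC ::
  "(real^'m \<Rightarrow> ereal) \<Rightarrow> (real^'n \<Rightarrow> real^'m) \<Rightarrow> real^'n \<Rightarrow> real^'m \<Rightarrow> bool" where
  "SOQC g \<Phi> x l \<longleftrightarrow>
     coderivative (subdifferential g) (\<Phi> x) l 0 \<inter>
       {w. transpose (jacobian \<Phi> (at x)) *v w = 0} = {0}"

definition prox :: "real \<Rightarrow> ('a::real_normed_vector \<Rightarrow> ereal) \<Rightarrow> 'a \<Rightarrow> 'a set" where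
  "prox r \<phi> x =
     {w. is_arg_min (\<lambda>w. \<phi> w + ereal (1 / (2 * r) * (norm (w - x))\<^sup>2)) (\<lambda>_. True) w}"

definition moreau_envelope :: "real \<Rightarrow> ('a::real_normed_vector \<Rightarrow> ereal) \<Rightarrow> 'a \<Rightarrow> ereal" where
  "moreau_envelope r \<phi> x = (INF w. \<phi> w + ereal (1 / (2 * r) * (norm (w - x))\<^sup>2))"

definition prox_bounded :: "('a::real_normed_vector \<Rightarrow> ereal) \<Rightarrow> bool" where
  "prox_bounded \<phi> \<longleftrightarrow> (\<exists>\<alpha> \<beta> :: real. \<forall>x. ereal \<beta> \<le> \<phi> x + ereal (\<alpha> * (norm x)\<^sup>2))"

end

theory Submission
  imports Defs
begin

text \<open>
  Let \<open>C = \<partial>g(\<Phi>(xbar))\<close>, let \<open>S\<close> be the direction space of the affine hull of \<open>C\<close>, and \<open>P\<close> the orthogonal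
  projection onto \<open>S\<close>. Polyhedrality makes \<open>g\<close> locally the support function of \<open>C\<close>, and SOQC implies
  that the transposed Jacobian is injective on \<open>S\<close>; so \<open>P \<circ> \<Phi>\<close> is a submersion, \<open>\<partial>\<phi>(xbar)\<close> is the image
  of \<open>C\<close> under the transposed Jacobian, and (c) says that the multiplier lies in \<open>ri C\<close>.

  Subgradients at points near \<open>xbar\<close> with multipliers near \<open>lbar\<close> satisfy a global quadratic
  minorization with a uniform constant, by Taylor expansion near \<open>xbar\<close> and prox-boundedness
  elsewhere. Hence, for small \<open>r\<close>, solutions of the optimality system are global proximal points. If
  \<open>lbar \<in> ri C\<close>, this system reduces to smooth equations whose solution is \<open>C\<^sup>1\<close> by the inverse
  function theorem, which gives (a); and (a) yields (b) since the gradient of the envelope is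
  \<open>(x - prox(x)) / r\<close>. Conversely, if the envelope is \<open>C\<^sup>2\<close>, the derivative \<open>L\<close> of the proximal map is
  monotone, so its range is orthogonal to its kernel; the kernel contains the image of \<open>S\<close>, and a
  supporting direction of \<open>C\<close> at a relative boundary point \<open>lbar\<close> would produce an element of the
  range violating this.
\<close>

section \<open>Projections, smooth maps and curves\<close>

lemma subspace_projection:
  fixes S :: "'a::euclidean_space set"
  assumes "subspace S"
  obtains P where "bounded_linear P" "\<And>x. P x \<in> S" "\<And>s x. s \<in> S \<Longrightarrow> s \<bullet> P x = s \<bullet> x"
    "\<And>s. s \<in> S \<Longrightarrow> P s = s"
proof -
  obtain B where B: "B \<subseteq> S" "pairwise orthogonal B" "\<And>x. x \<in> B \<Longrightarrow> norm x = 1" "independent B"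
    "span B = S"
    using orthonormal_basis_subspace[OF assms] by metis
  have fin: "finite B"
    using B(4) independent_imp_finite by blast
  define P where "P x = (\<Sum>b\<in>B. (x \<bullet> b) *\<^sub>R b)" for x
  have lin: "bounded_linear P"
    unfolding P_def by (intro bounded_linear_intros)
  have PS: "P x \<in> S" for x
    unfolding P_def using B(1) assms by (meson subsetD subspace_scale subspace_sum)
  have Pb: "b \<bullet> P x = b \<bullet> x" if b: "b \<in> B" for b x
  proof -
    have "b \<bullet> P x = (\<Sum>c\<in>B. (x \<bullet> c) * (b \<bullet> c))"
      by (simp add: P_def inner_sum_right)
    also have "\<dots> = (\<Sum>c\<in>B. if c = b then x \<bullet> b else 0)"
      using B(2) B(3)[OF b] b by (intro sum.cong) (auto simp: pairwise_def orthogonal_def norm_eq_1)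
    finally show ?thesis
      using b fin by (simp add: inner_commute)
  qed
  have orth: "s \<bullet> P x = s \<bullet> x" if "s \<in> S" for s x
  proof -
    have "s \<in> span B" using that B by simp
    then show ?thesis
      by (induction rule: span_induct_alt) (auto simp: inner_add_left Pb)
  qed
  have "P s = s" if "s \<in> S" for s
  proof -
    have "P s - s \<in> S"
      using PS that assms by (simp add: subspace_diff)
    from orth[OF this, of s] show ?thesis
      by (metis inner_diff_right inner_eq_zero_iff right_minus_eq)
  qed
  with lin PS orth that show ?thesis by blast
qed

text \<open>Continuity of operator inversion follows from
  \<open>B y - B x = - B x (A y - A x) B y\<close>. Once \<open>A y\<close> is close to
  \<open>A x\<close>, the identity first bounds \<open>B y\<close> by twice
  \<open>norm (B x)\<close> and then gives a Lipschitz estimate in \<open>A y - A x\<close>.\<close>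

lemma tendsto_blinfun_inverse:
  fixes A B :: "'c::t2_space \<Rightarrow> 'a::euclidean_space \<Rightarrow>\<^sub>L 'a"
  assumes cont: "(A \<longlongrightarrow> A x) (at x)"
    and inv: "\<And>h. A x (B x h) = h" "\<And>h. B x (A x h) = h"
    and inv': "\<forall>\<^sub>F y in at x. \<forall>h. A y (B y h) = h"
  shows "(B \<longlongrightarrow> B x) (at x)"
proof -
  define K where "K = norm (B x)"
  have K0: "K \<ge> 0" by (simp add: K_def)
  have lim0: "((\<lambda>y. norm (A y - A x)) \<longlongrightarrow> 0) (at x)"
    using cont by (simp add: LIM_zero tendsto_norm_zero)
  \<comment> \<open>This radius makes \<open>K * norm (A y - A x)\<close> at most 1/2, so that the
    term containing \<open>B y\<close> can be absorbed on the left; the added 1 covers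
    \<open>K = 0\<close>.\<close>
  have ev: "\<forall>\<^sub>F y in at x. norm (A y - A x) < 1 / (2 * (K + 1))"
    using order_tendstoD(2)[OF lim0, of "1 / (2 * (K + 1))"] K0 by simp
  have bnd: "norm (B y - B x) \<le> 2 * K * K * norm (A y - A x)"
    if y: "\<forall>h. A y (B y h) = h" "norm (A y - A x) < 1 / (2 * (K + 1))" for y
  proof -
    have id: "B y h - B x h = - B x ((A y - A x) (B y h))" for h
      using y(1) inv(2)[of "B y h"] by (simp add: blinfun.diff_left blinfun.diff_right)
    have half: "K * norm (A y - A x) \<le> 1/2"
    proof -
      have "K * norm (A y - A x) \<le> (K + 1) * (1 / (2 * (K + 1)))"
        using y(2) K0 by (intro mult_mono) auto
      also have "\<dots> = 1/2" using K0 by (simp add: field_simps)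
      finally show ?thesis .
    qed
    have le: "norm (B y h - B x h) \<le> K * norm (A y - A x) * norm (B y h)" for h
    proof -
      have "norm (B y h - B x h) \<le> norm (B x) * (norm (A y - A x) * norm (B y h))"
        unfolding id norm_minus_cancel
        by (meson mult_left_mono norm_blinfun norm_ge_zero order_trans)
      then show ?thesis by (simp add: K_def mult.assoc)
    qed
    have Bx: "norm (B x h) \<le> K * norm h" for h
      by (simp add: K_def norm_blinfun)
    have By: "norm (B y h) \<le> 2 * K * norm h" for h
    proof -
      have "norm (B y h) \<le> norm (B x h) + norm (B y h - B x h)"
        by norm
      also have "\<dots> \<le> K * norm h + 1/2 * norm (B y h)"
        using Bx[of h] le[of h] half by (meson add_mono mult_right_mono norm_ge_zero order_trans)
      finally show ?thesis by simp
    qed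
    show ?thesis
    proof (rule norm_blinfun_bound)
      show "norm ((B y - B x) h) \<le> 2 * K * K * norm (A y - A x) * norm h" for h
      proof -
        have "norm ((B y - B x) h) \<le> K * norm (A y - A x) * norm (B y h)"
          using le[of h] by (simp add: blinfun.diff_left)
        also have "\<dots> \<le> K * norm (A y - A x) * (2 * K * norm h)"
          using By[of h] K0 by (intro mult_left_mono) auto
        finally show ?thesis by (simp add: algebra_simps)
      qed
    qed (use K0 in auto)
  qed
  have "((\<lambda>y. B y - B x) \<longlongrightarrow> 0) (at x)"
  proof (rule Lim_null_comparison)
    show "\<forall>\<^sub>F y in at x. norm (B y - B x) \<le> 2 * K * K * norm (A y - A x)"
      using ev inv' by eventually_elim (use bnd in auto)
    show "((\<lambda>y. 2 * K * K * norm (A y - A x)) \<longlongrightarrow> 0) (at x)"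
      using tendsto_mult_left[OF lim0] by simp
  qed
  then show ?thesis by (simp add: LIM_zero_iff)
qed

text \<open>In finite dimension injectivity of the derivative already makes it invertible. The
  derivative of the inverse is \<open>inv (f' (g y))\<close>, and its continuity in operator norm
  comes from \<open>tendsto_blinfun_inverse\<close> along \<open>f' o g\<close>. The neighbourhood
  \<open>U'\<close> and the derivative formula are kept because curves are later pulled back through
  the inverse.\<close>

lemma inverse_function_theorem_C1:
  fixes f :: "'a::euclidean_space \<Rightarrow> 'a" and f' :: "'a \<Rightarrow> ('a \<Rightarrow>\<^sub>L 'a)"
  assumes U: "open U" "x0 \<in> U"
    and derf: "\<And>x. x \<in> U \<Longrightarrow> (f has_derivative blinfun_apply (f' x)) (at x)"
    and contf: "continuous_on U f'"
    and inj: "\<And>h. f' x0 h = 0 \<Longrightarrow> h = 0"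
  obtains U' V g where "open U'" "U' \<subseteq> U" "x0 \<in> U'" "open V" "homeomorphism U' V f g"
    "C1_on V g"
    "\<And>x. x \<in> U' \<Longrightarrow> (g has_derivative inv (blinfun_apply (f' x))) (at (f x))"
    "\<And>x. x \<in> U' \<Longrightarrow> bij (blinfun_apply (f' x))"
proof -
  have lin: "linear (blinfun_apply (f' x))" for x
    by (simp add: blinfun.bounded_linear_right bounded_linear.linear)
  have injl: "inj (blinfun_apply (f' x0))"
    using inj lin by (simp add: linear_injective_0)
  obtain h where h: "linear h" "\<And>x. h (f' x0 x) = x" "\<And>x. f' x0 (h x) = x"
    using linear_injective_isomorphism[OF lin injl] by blast
  have "Blinfun h o\<^sub>L f' x0 = id_blinfun"
    by (rule blinfun_eqI) (simp add: bounded_linear_Blinfun_apply linear_conv_bounded_linear[THEN iffD1, OF h(1)] h)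
  from inverse_function_theorem[OF U(1) derf contf U(2) this]
  obtain U' V g g' where *: "open U'" "U' \<subseteq> U" "x0 \<in> U'" "open V" "homeomorphism U' V f g"
    "\<And>y. y \<in> V \<Longrightarrow> (g has_derivative g' y) (at y)"
    "\<And>y. y \<in> V \<Longrightarrow> g' y = inv (blinfun_apply (f' (g y)))"
    "\<And>y. y \<in> V \<Longrightarrow> bij (blinfun_apply (f' (g y)))"
    by metis
  have gU: "g y \<in> U'" if "y \<in> V" for y
    using *(5) that by (auto simp: homeomorphism_def)
  have fV: "f x \<in> V" "g (f x) = x" if "x \<in> U'" for x
    using *(5) that by (auto simp: homeomorphism_def)
  define B where "B y = Blinfun (g' y)" for y
  have B: "blinfun_apply (B y) = g' y" if "y \<in> V" for y
    unfolding B_def using *(6)[OF that] has_derivative_bounded_linear bounded_linear_Blinfun_apply by blast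
  have "C1_on V g"
    unfolding C1_on_def
  proof (intro exI[of _ B] conjI ballI)
    show "(g has_derivative blinfun_apply (B y)) (at y)" if "y \<in> V" for y
      using *(6) B that by auto
    show "continuous_on V B"
    proof (rule continuous_at_imp_continuous_on, rule ballI)
      fix y assume y: "y \<in> V"
      have cg: "isCont g y"
        using *(6)[OF y] has_derivative_continuous by blast
      have "isCont f' (g y)"
        using contf gU[OF y] *(2) U(1) by (meson continuous_on_eq_continuous_at subsetD)
      then have 1: "isCont (\<lambda>y. f' (g y)) y"
        using cg by (rule isCont_o2[rotated])
      have B1: "f' (g z) (B z h) = h" if "z \<in> V" for z h
        using B[OF that] *(7,8)[OF that] by (simp add: bij_is_surj surj_f_inv_f)
      have B2: "B y (f' (g y) h) = h" for h
        using B[OF y] *(7,8)[OF y] by (simp add: bij_is_inj)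
      have "(B \<longlongrightarrow> B y) (at y)"
      proof (rule tendsto_blinfun_inverse)
        show "((\<lambda>y. f' (g y)) \<longlongrightarrow> f' (g y)) (at y)"
          using 1 by (simp add: isCont_def)
        show "\<forall>\<^sub>F z in at y. \<forall>h. f' (g z) (B z h) = h"
          using eventually_at_in_open'[OF *(4) y] by eventually_elim (use B1 in auto)
      qed (use B1 y B2 in auto)
      then show "isCont B y" by (simp add: isCont_def)
    qed
  qed
  moreover have "(g has_derivative inv (blinfun_apply (f' x))) (at (f x))" if "x \<in> U'" for x
    using *(6,7)[of "f x"] fV[OF that] by simp
  moreover have "bij (blinfun_apply (f' x))" if "x \<in> U'" for x
    using *(8)[of "f x"] fV[OF that] by simp
  ultimately show ?thesis
    using that * by blast
qed

text \<open>Applied with \<open>h = fst\<close> and \<open>k y = (y, 0)\<close>: it extracts the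
  proximal map from the local inverse of the optimality system.\<close>

lemma C1_on_bounded_linear_comp:
  assumes "C1_on V g" "bounded_linear h" "bounded_linear k"
  shows "C1_on {x. k x + c \<in> V} (\<lambda>x. h (g (k x + c)))"
proof -
  obtain D where D: "\<And>y. y \<in> V \<Longrightarrow> (g has_derivative blinfun_apply (D y)) (at y)" "continuous_on V D"
    using assms(1) by (auto simp: C1_on_def)
  define D' where "D' x = Blinfun h o\<^sub>L D (k x + c) o\<^sub>L Blinfun k" for x
  show ?thesis
    unfolding C1_on_def
  proof (intro exI[of _ D'] conjI ballI)
    fix x assume "x \<in> {x. k x + c \<in> V}"
    then have "(g has_derivative blinfun_apply (D (k x + c))) (at (k x + c))"
      using D by simp
    then have "((\<lambda>x. g (k x + c)) has_derivative (\<lambda>u. D (k x + c) (k u))) (at x)"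
      by (rule has_derivative_compose[rotated])
         (auto intro!: derivative_eq_intros bounded_linear_imp_has_derivative assms(3))
    then have "((\<lambda>x. h (g (k x + c))) has_derivative (\<lambda>u. h (D (k x + c) (k u)))) (at x)"
      by (rule bounded_linear.has_derivative[OF assms(2)])
    moreover have "blinfun_apply (D' x) = (\<lambda>u. h (D (k x + c) (k u)))"
      by (rule ext) (simp add: D'_def bounded_linear_Blinfun_apply assms)
    ultimately show "((\<lambda>x. h (g (k x + c))) has_derivative blinfun_apply (D' x)) (at x)"
      by simp
  next
    have "continuous_on {x. k x + c \<in> V} (\<lambda>x. D (k x + c))"
      by (rule continuous_on_compose2[OF D(2)])
        (auto intro!: continuous_intros bounded_linear.continuous_on[OF assms(3)])
    then show "continuous_on {x. k x + c \<in> V} D'"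
      unfolding D'_def by (intro continuous_intros)
  qed
qed

lemma tendsto_difference_quotient:
  assumes "(c has_vector_derivative w) (at (0::real))"
  shows "((\<lambda>t. (1 / t) *\<^sub>R (c t - c 0)) \<longlongrightarrow> w) (at 0)"
proof -
  have "((\<lambda>t. norm (c t - c 0 - t *\<^sub>R w) / norm t) \<longlongrightarrow> 0) (at 0)"
    using assms unfolding has_vector_derivative_def has_derivative_at by simp
  then have "((\<lambda>t. (1 / t) *\<^sub>R (c t - c 0) - w) \<longlongrightarrow> 0) (at 0)"
  proof (rule Lim_null_comparison[rotated])
    show "\<forall>\<^sub>F t in at 0. norm ((1 / t) *\<^sub>R (c t - c 0) - w) \<le> norm (c t - c 0 - t *\<^sub>R w) / norm t"
      unfolding eventually_at_filter
    proof (intro always_eventually allI impI)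
      fix t :: real assume t: "t \<noteq> 0"
      have "(1 / t) *\<^sub>R (c t - c 0) - w = (1 / t) *\<^sub>R (c t - c 0 - t *\<^sub>R w)"
        using t by (simp add: scaleR_right_diff_distrib)
      then show "norm ((1 / t) *\<^sub>R (c t - c 0) - w) \<le> norm (c t - c 0 - t *\<^sub>R w) / norm t"
        using t by simp
    qed
  qed
  then show ?thesis by (simp add: LIM_zero_iff)
qed

text \<open>One-sided difference quotients determine a derivative that exists. Agreement for
  positive times is all that is available later, since the curves of proximal points are identified
  only for \<open>t > 0\<close>.\<close>

lemma vector_derivative_eq_at_right:
  assumes c: "(c has_vector_derivative v) (at (0::real))" and d: "(d has_vector_derivative w) (at 0)"
    and eq: "c 0 = d 0" "\<forall>\<^sub>F t in at_right 0. c t = d t"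
  shows "v = w"
proof -
  have "\<forall>\<^sub>F t in at_right 0. (1 / t) *\<^sub>R (c t - c 0) = (1 / t) *\<^sub>R (d t - d 0)"
    using eq(2) by eventually_elim (simp add: eq(1))
  moreover have "((\<lambda>t. (1 / t) *\<^sub>R (c t - c 0)) \<longlongrightarrow> v) (at_right 0)"
    by (rule tendsto_within_subset[OF tendsto_difference_quotient[OF c]]) simp
  ultimately have "((\<lambda>t. (1 / t) *\<^sub>R (d t - d 0)) \<longlongrightarrow> v) (at_right 0)"
    by (rule Lim_transform_eventually[rotated])
  moreover have "((\<lambda>t. (1 / t) *\<^sub>R (d t - d 0)) \<longlongrightarrow> w) (at_right 0)"
    by (rule tendsto_within_subset[OF tendsto_difference_quotient[OF d]]) simp
  ultimately show ?thesis
    by (rule tendsto_unique[OF trivial_limit_at_right_real])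
qed

lemma tangent_cone_curve:
  assumes c: "(c has_vector_derivative w) (at 0)" and S: "\<forall>\<^sub>F t in at_right 0. c t \<in> S"
  shows "w \<in> tangent_cone S (c 0)"
proof -
  obtain b where b: "b > 0" "\<And>t. 0 < t \<Longrightarrow> t < b \<Longrightarrow> c t \<in> S"
    using S unfolding eventually_at_right_field by auto
  \<comment> \<open>The double successor gives \<open>b / (k + 2)\<close>, which stays strictly
    below \<open>b\<close> already at \<open>k = 0\<close>.\<close>
  define t where "t k = b * inverse (real (Suc (Suc k)))" for k
  have t0: "0 < t k" "t k < b" for k
    using b(1) mult_strict_left_mono[of "inverse (real (Suc (Suc k)))" 1 b]
    by (auto simp: t_def inverse_less_1_iff)
  have t: "t \<longlonglongrightarrow> 0"
    unfolding t_def using tendsto_mult_left[OF LIMSEQ_Suc[OF LIMSEQ_inverse_real_of_nat], of b] by simp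
  have "filterlim t (at 0) sequentially"
    using t t0(1) by (auto simp: filterlim_at order_less_imp_not_eq2 intro!: always_eventually)
  from filterlim_compose[OF tendsto_difference_quotient[OF c] this]
  have "(\<lambda>k. (1 / t k) *\<^sub>R (c (t k) - c 0)) \<longlonglongrightarrow> w" .
  moreover have "c 0 + t k *\<^sub>R (1 / t k) *\<^sub>R (c (t k) - c 0) \<in> S" for k
    using b(2)[OF t0] t0(1)[of k] by simp
  ultimately show ?thesis
    using t t0(1) unfolding tangent_cone_def by blast
qed

section \<open>Proximal mappings and Moreau envelopes\<close>

lemma mem_prox_iff:
  "w \<in> prox r \<phi> x \<longleftrightarrow> (\<forall>y. \<phi> w + ereal (1 / (2 * r) * (norm (w - x))\<^sup>2) \<le> \<phi> y + ereal (1 / (2 * r) * (norm (y - x))\<^sup>2))"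
  by (auto simp: prox_def is_arg_min_def not_less)

lemma moreau_envelope_prox:
  assumes "w \<in> prox r \<phi> x"
  shows "moreau_envelope r \<phi> x = \<phi> w + ereal (1 / (2 * r) * (norm (w - x))\<^sup>2)"
  unfolding moreau_envelope_def using assms unfolding mem_prox_iff
  by (intro antisym INF_lower INF_greatest) auto

text \<open>Around \<open>w + r v\<close> the proximal term is
  \<open>norm (y - w)^2 / (2 r) - v . (y - w)\<close> plus a constant. The linear part cancels the
  one in the minorant, and \<open>r * \<rho> < 1\<close> leaves a strictly positive quadratic excess
  away from \<open>w\<close>.\<close>

lemma prox_eq_singleton:
  fixes \<phi> :: "'a::real_inner \<Rightarrow> ereal"
  assumes w: "\<phi> w = ereal c" and r: "r > 0" "r * \<rho> < 1"
    and le: "\<And>y. ereal (c + v \<bullet> (y - w) - \<rho> / 2 * (norm (y - w))\<^sup>2) \<le> \<phi> y"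
  shows "prox r \<phi> (w + r *\<^sub>R v) = {w}"
proof -
  let ?f = "\<lambda>y. \<phi> y + ereal (1 / (2 * r) * (norm (y - (w + r *\<^sub>R v)))\<^sup>2)"
  have sq: "1 / (2 * r) * (norm (y - (w + r *\<^sub>R v)))\<^sup>2 =
      1 / (2 * r) * (norm (y - w))\<^sup>2 - v \<bullet> (y - w) + 1 / (2 * r) * (norm (w - (w + r *\<^sub>R v)))\<^sup>2" for y
  proof -
    have "(norm (y - (w + r *\<^sub>R v)))\<^sup>2 = (norm (y - w))\<^sup>2 - 2 * r * (v \<bullet> (y - w)) + (norm (w - (w + r *\<^sub>R v)))\<^sup>2"
      unfolding power2_norm_eq_inner by (simp add: algebra_simps inner_commute)
    then show ?thesis using r by (simp add: field_simps)
  qed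
  have gt: "?f w < ?f y" if "y \<noteq> w" for y
  proof -
    define K where "K = 1 / (2 * r) * (norm (w - (w + r *\<^sub>R v)))\<^sup>2"
    have "\<rho> / 2 < 1 / (2 * r)" using r by (simp add: field_simps)
    then have "\<rho> / 2 * (norm (y - w))\<^sup>2 < 1 / (2 * r) * (norm (y - w))\<^sup>2"
      using that by (intro mult_strict_right_mono) auto
    then have "ereal (c + K) < ereal (c + v \<bullet> (y - w) - \<rho> / 2 * (norm (y - w))\<^sup>2) +
      ereal (1 / (2 * r) * (norm (y - w))\<^sup>2 - v \<bullet> (y - w) + K)"
      by simp
    also have "\<dots> \<le> ?f y" unfolding sq[of y] K_def by (intro add_mono le order_refl)
    finally show ?thesis using w by (simp add: K_def)
  qed
  show ?thesis
  proof safe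
    show "w \<in> prox r \<phi> (w + r *\<^sub>R v)"
      unfolding mem_prox_iff using gt by (metis order.refl less_imp_le)
    show "y = w" if "y \<in> prox r \<phi> (w + r *\<^sub>R v)" for y
      using that gt[of y] unfolding mem_prox_iff by (metis not_less)
  qed
qed

lemma norm_diff_sq_expand:
  fixes w x y :: "'a::real_inner"
  shows "(norm (w - y))\<^sup>2 - (norm (w - x))\<^sup>2 = 2 * ((x - w) \<bullet> (y - x)) + (norm (y - x))\<^sup>2"
  unfolding power2_norm_eq_inner by (simp add: algebra_simps inner_commute)

text \<open>A minimizer at \<open>x\<close> provides a smooth majorant of the envelope that touches it at \<open>x\<close>.\<close>

lemma moreau_envelope_derivative:
  fixes \<phi> :: "'a::real_inner \<Rightarrow> ereal"
  assumes e: "\<forall>\<^sub>F y in nhds x. moreau_envelope r \<phi> y = ereal (e y)"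
    and w: "w \<in> prox r \<phi> x" "\<phi> w = ereal c" and r: "r > 0"
    and der: "(e has_derivative e') (at x)"
  shows "e' h = (1 / r) * ((x - w) \<bullet> h)"
proof -
  obtain S where S: "open S" "x \<in> S" "\<And>y. y \<in> S \<Longrightarrow> moreau_envelope r \<phi> y = ereal (e y)"
    using e by (auto simp: eventually_nhds)
  define q where "q y = c + 1 / (2 * r) * (norm (w - y))\<^sup>2" for y
  have qx: "e x = q x"
    using moreau_envelope_prox[OF w(1)] S(2,3) w(2) by (auto simp: q_def)
  have le: "e y \<le> q y" if "y \<in> S" for y
  proof -
    have "ereal (e y) \<le> \<phi> w + ereal (1 / (2 * r) * (norm (w - y))\<^sup>2)"
      unfolding S(3)[OF that, symmetric] moreau_envelope_def by (rule INF_lower) auto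
    then show ?thesis using w(2) by (simp add: q_def)
  qed
  have qder: "(q has_derivative (\<lambda>h. (1 / r) * ((x - w) \<bullet> h))) (at x)"
    unfolding q_def power2_norm_eq_inner
    using r by (auto intro!: derivative_eq_intros simp: fun_eq_iff field_simps inner_commute inner_diff)
  have "(\<lambda>h. e' h - (1 / r) * ((x - w) \<bullet> h)) = (\<lambda>h. 0)"
    using differential_zero_maxmin[OF S(2,1) has_derivative_diff[OF der qder]] le qx by force
  then show ?thesis by (simp add: fun_eq_iff)
qed

text \<open>Using \<open>p y\<close> as a competitor at \<open>z\<close> bounds
  \<open>e z - e y\<close> from above by its expected linearization plus a square; exchanging
  \<open>y\<close> and \<open>z\<close> bounds it from below. Continuity of \<open>p\<close> makes
  the two bounds agree to first order, so the gradient is \<open>(y - p y) / r\<close>, which is as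
  smooth as \<open>p\<close>.\<close>

lemma prox_C1_imp_moreau_C2:
  fixes \<phi> :: "'a::real_inner \<Rightarrow> ereal"
  assumes r: "r > 0" and pb: "prox_bounded \<phi>" and fin: "\<bar>\<phi> a\<bar> \<noteq> \<infinity>"
    and C1: "set_valued_C1_around (prox r \<phi>) x"
  shows "ereal_C2_around (moreau_envelope r \<phi>) x"
proof -
  obtain p U0 where p: "\<forall>\<^sub>F y in nhds x. prox r \<phi> y = {p y}" "open U0" "x \<in> U0" "C1_on U0 p"
    using C1 by (auto simp: set_valued_C1_around_def C1_around_def)
  then obtain U1 where U1: "open U1" "x \<in> U1" "\<And>y. y \<in> U1 \<Longrightarrow> prox r \<phi> y = {p y}"
    by (auto simp: eventually_nhds)
  define U where "U = U0 \<inter> U1"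
  have U: "open U" "x \<in> U" using p U1 by (auto simp: U_def)
  obtain D where D: "\<And>y. y \<in> U \<Longrightarrow> (p has_derivative blinfun_apply (D y)) (at y)" "continuous_on U D"
    using p(4) by (auto simp: C1_on_def U_def intro: continuous_on_subset)
  have pm: "p y \<in> prox r \<phi> y" if "y \<in> U" for y
    using U1(3) that by (auto simp: U_def)
  \<comment> \<open>The value at a proximal point is finite: prox-boundedness excludes minus
    infinity, comparison with \<open>a\<close> excludes infinity.\<close>
  define c where "c y = real_of_ereal (\<phi> (p y))" for y
  have c: "\<phi> (p y) = ereal (c y)" if "y \<in> U" for y
  proof -
    obtain \<alpha> \<beta> where "ereal \<beta> \<le> \<phi> (p y) + ereal \<alpha>"
      using pb unfolding prox_bounded_def by blast
    moreover have "\<phi> (p y) + ereal (1 / (2 * r) * (norm (p y - y))\<^sup>2) \<le> \<phi> a + ereal (1 / (2 * r) * (norm (a - y))\<^sup>2)"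
      using pm[OF that] unfolding mem_prox_iff by blast
    ultimately show ?thesis
      using fin unfolding c_def by (cases "\<phi> (p y)"; cases "\<phi> a") auto
  qed
  define e where "e y = c y + 1 / (2 * r) * (norm (p y - y))\<^sup>2" for y
  have e: "moreau_envelope r \<phi> y = ereal (e y)" if "y \<in> U" for y
    using moreau_envelope_prox[OF pm[OF that]] c[OF that] by (simp add: e_def)
  define k where "k = 1 / (2 * r)"
  have k: "k > 0" "1 / r = 2 * k" using r by (simp_all add: k_def)
  have up: "e z - e y \<le> k * (2 * ((y - p y) \<bullet> (z - y)) + (norm (z - y))\<^sup>2)"
    if "y \<in> U" "z \<in> U" for y z
  proof -
    have "moreau_envelope r \<phi> z \<le> \<phi> (p y) + ereal (1 / (2 * r) * (norm (p y - z))\<^sup>2)"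
      unfolding moreau_envelope_def by (rule INF_lower) auto
    then have "e z \<le> c y + 1 / (2 * r) * (norm (p y - z))\<^sup>2"
      using e[OF that(2)] c[OF that(1)] by simp
    then show ?thesis
      unfolding norm_diff_sq_expand[symmetric] e_def[of y] k_def by (simp add: algebra_simps)
  qed
  define E where "E y = blinfun_inner_right ((1 / r) *\<^sub>R (y - p y))" for y
  have der: "(e has_derivative blinfun_apply (E y)) (at y)" if y: "y \<in> U" for y
    unfolding has_derivative_iff_norm
  proof (intro conjI)
    \<comment> \<open>\<open>?R\<close> bounds the remainder divided by \<open>norm (z - y)\<close>:
      the first summand is the variation of the candidate gradient, the second comes from the
      square.\<close>
    let ?R = "\<lambda>z. 2 * k * norm (z - p z - (y - p y)) + k * norm (z - y)"
    show "((\<lambda>z. norm (e z - e y - blinfun_apply (E y) (z - y)) / norm (z - y)) \<longlongrightarrow> 0) (at y)"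
    proof (rule Lim_null_comparison)
      have "isCont p y" using D(1)[OF y] has_derivative_continuous by blast
      then have "(?R \<longlongrightarrow> 2 * k * norm (y - p y - (y - p y)) + k * norm (y - y)) (at y)"
        unfolding isCont_def by (intro tendsto_intros) auto
      then show "(?R \<longlongrightarrow> 0) (at y)" by simp
      show "\<forall>\<^sub>F z in at y. norm (norm (e z - e y - blinfun_apply (E y) (z - y)) / norm (z - y)) \<le> ?R z"
        using eventually_at_in_open[OF U(1) y]
      proof eventually_elim
        case (elim z)
        then have z: "z \<in> U" "z \<noteq> y" by auto
        define d where "d = z - p z - (y - p y)"
        define N where "N = norm (z - y)"
        define A where "A = (y - p y) \<bullet> (z - y)"
        define B where "B = d \<bullet> (z - y)"
        define X where "X = e z - e y - 2 * k * A"
        have a: "X \<le> k * N\<^sup>2"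
          using up[OF y z(1)] by (simp add: X_def A_def N_def algebra_simps)
        have "e y - e z \<le> k * (2 * ((z - p z) \<bullet> (y - z)) + N\<^sup>2)"
          using up[OF z(1) y] by (simp add: N_def norm_minus_commute)
        moreover have "(z - p z) \<bullet> (y - z) = - B - A"
          by (simp add: A_def B_def d_def algebra_simps)
        ultimately have "e y - e z \<le> k * (2 * (- B - A) + N\<^sup>2)" by simp
        then have b: "- X \<le> k * N\<^sup>2 - 2 * k * B"
          by (simp add: X_def algebra_simps)
        have "\<bar>B\<bar> \<le> norm d * N"
          unfolding B_def N_def by (rule Cauchy_Schwarz_ineq2)
        then have "2 * k * (- B) \<le> 2 * k * (norm d * N)"
          using k(1) by (intro mult_left_mono) auto
        moreover have "0 \<le> 2 * k * (norm d * N)"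
          using k(1) by (simp add: N_def)
        ultimately have "\<bar>X\<bar> \<le> 2 * k * (norm d * N) + k * N\<^sup>2"
          using a b by (intro abs_leI; linarith)
        also have "\<dots> = (2 * k * norm d + k * N) * N" by (simp add: algebra_simps power2_eq_square)
        finally have "\<bar>X\<bar> / N \<le> 2 * k * norm d + k * N"
          using z by (simp add: divide_le_eq N_def)
        then show ?case by (simp add: E_def k(2) X_def A_def N_def d_def)
      qed
    qed
  qed (rule blinfun.bounded_linear_right)
  define E' where "E' y = Blinfun blinfun_inner_right o\<^sub>L ((1 / r) *\<^sub>R (id_blinfun - D y))" for y
  have "(E has_derivative blinfun_apply (E' y)) (at y)" if "y \<in> U" for y
  proof -
    have "(E has_derivative (\<lambda>h. blinfun_inner_right ((1 / r) *\<^sub>R (h - D y h)))) (at y)"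
      unfolding E_def
      by (rule bounded_linear.has_derivative[OF bounded_linear_blinfun_inner_right])
         (intro derivative_intros D that)
    moreover have "blinfun_apply (E' y) = (\<lambda>h. blinfun_inner_right ((1 / r) *\<^sub>R (h - D y h)))"
      by (rule ext) (simp add: E'_def bounded_linear_Blinfun_apply[OF bounded_linear_blinfun_inner_right]
          blinfun.diff_left blinfun.scaleR_left)
    ultimately show ?thesis by simp
  qed
  moreover have "continuous_on U E'"
    unfolding E'_def by (intro continuous_intros D)
  ultimately have "C1_on U E" by (auto simp: C1_on_def)
  then have "C2_on U e" using der by (auto simp: C2_on_def)
  moreover have "\<forall>\<^sub>F y in nhds x. moreau_envelope r \<phi> y = ereal (e y)"
    using e U by (auto simp: eventually_nhds)
  ultimately show ?thesis
    using U by (auto simp: ereal_C2_around_def C2_around_def)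
qed

section \<open>Normal cones and polyhedral functions\<close>

lemma regular_normal_cone_subset: "x \<in> S \<Longrightarrow> regular_normal_cone S x \<subseteq> normal_cone S x"
  unfolding normal_cone_def by (auto intro!: exI[of _ "\<lambda>_. x"] exI[of _ "\<lambda>_. v" for v])

lemma tangent_cone_convex:
  assumes "convex S" "x \<in> S" "y \<in> S"
  shows "y - x \<in> tangent_cone S x"
  unfolding tangent_cone_def
proof (intro CollectI exI conjI allI)
  show "(\<lambda>k. inverse (real (Suc k))) \<longlonglongrightarrow> 0"
    by (rule LIMSEQ_inverse_real_of_nat)
  show "x + inverse (real (Suc k)) *\<^sub>R (y - x) \<in> S" for k
    using convexD_alt[OF assms, of "inverse (real (Suc k))"]
    by (simp add: algebra_simps inverse_le_1_iff)
qed (auto intro: tendsto_const)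

lemma regular_normal_coneI:
  assumes "\<And>y. y \<in> S \<Longrightarrow> v \<bullet> (y - x) \<le> 0"
  shows "v \<in> regular_normal_cone S x"
  unfolding regular_normal_cone_def polar_cone_def tangent_cone_def
proof clarsimp
  fix w t u assume t: "\<forall>k. 0 < t k" and u: "u \<longlonglongrightarrow> w" "\<forall>k. x + t k *\<^sub>R u k \<in> S"
  have "v \<bullet> u k \<le> 0" for k
    using assms[of "x + t k *\<^sub>R u k"] t u(2) by (auto simp: mult_le_0_iff dest: spec[of _ k])
  then show "v \<bullet> w \<le> 0"
    using tendsto_inner[OF tendsto_const u(1), of v] by (intro LIMSEQ_le_const2) auto
qed

text \<open>At a nearby point \<open>a k\<close> of the set, \<open>y - a k\<close> is tangent, so
  regular normals there satisfy the variational inequality, and this inequality survives the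
  limit.\<close>

lemma normal_cone_convex:
  assumes "convex S" "x \<in> S"
  shows "normal_cone S x = {v. \<forall>y\<in>S. v \<bullet> (y - x) \<le> 0}"
proof safe
  fix v y assume "v \<in> normal_cone S x" and y: "y \<in> S"
  then obtain a u where a: "\<And>k. a k \<in> S" "\<And>k. u k \<in> regular_normal_cone S (a k)"
    "a \<longlonglongrightarrow> x" "u \<longlonglongrightarrow> v"
    by (auto simp: normal_cone_def)
  have "u k \<bullet> (y - a k) \<le> 0" for k
    using a(2)[of k] tangent_cone_convex[OF assms(1) a(1) y]
    by (auto simp: regular_normal_cone_def polar_cone_def)
  moreover have "(\<lambda>k. u k \<bullet> (y - a k)) \<longlonglongrightarrow> v \<bullet> (y - x)"
    by (intro tendsto_intros a)
  ultimately show "v \<bullet> (y - x) \<le> 0"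
    by (intro LIMSEQ_le_const2) auto
next
  fix v assume "\<forall>y\<in>S. v \<bullet> (y - x) \<le> 0"
  then show "v \<in> normal_cone S x"
    using regular_normal_coneI[of S v x] regular_normal_cone_subset[OF assms(2)] by blast
qed

text \<open>The subgradient inequality is tested on points of the epigraph, so that it compares real
  numbers even where \<open>g\<close> takes infinite values.\<close>

lemma subdifferential_convex:
  assumes "convex (epi g)"
  shows "l \<in> subdifferential g z \<longleftrightarrow> \<bar>g z\<bar> \<noteq> \<infinity> \<and>
    (\<forall>z' \<alpha>. g z' \<le> ereal \<alpha> \<longrightarrow> real_of_ereal (g z) + l \<bullet> (z' - z) \<le> \<alpha>)"
proof (cases "\<bar>g z\<bar> = \<infinity>")
  case False
  then have "(z, real_of_ereal (g z)) \<in> epi g"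
    by (auto simp: epi_def ereal_real)
  from normal_cone_convex[OF assms this] False show ?thesis
    by (auto simp: subdifferential_def epi_def algebra_simps)
qed (simp add: subdifferential_def)

lemma
  assumes "convex (epi g)"
  shows closed_subdifferential: "closed (subdifferential g z)"
    and convex_subdifferential: "convex (subdifferential g z)"
proof -
  have eq: "subdifferential g z = (if \<bar>g z\<bar> = \<infinity> then {} else
      (\<Inter>(z', \<alpha>) \<in> {(z', \<alpha>). g z' \<le> ereal \<alpha>}. {l. (z' - z) \<bullet> l \<le> \<alpha> - real_of_ereal (g z)}))"
    using subdifferential_convex[OF assms, of _ z] by (auto simp: inner_commute algebra_simps)
  show "closed (subdifferential g z)" "convex (subdifferential g z)"
    unfolding eq by (auto intro!: closed_INT convex_INT closed_halfspace_le convex_halfspace_le)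
qed

section \<open>Polyhedral functions: local model, nearby subgradients and coderivative\<close>

text \<open>Only half-spaces active at \<open>(z, \<gamma>)\<close> matter near \<open>z\<close>,
  and each of those is a consequence of the subgradient inequalities. Hence the epigraph locally
  coincides with its tangent cone, which is the epigraph of the support function of the
  subdifferential.\<close>

lemma polyhedral_local_model:
  fixes g :: "'a::euclidean_space \<Rightarrow> ereal"
  assumes poly: "polyhedral_fun g" and gz: "g z = ereal \<gamma>" and l0: "l0 \<in> subdifferential g z"
  obtains \<epsilon> where "\<epsilon> > 0" "\<And>d \<tau>. norm d < \<epsilon> \<Longrightarrow>
    g (z + d) \<le> ereal (\<gamma> + \<tau>) \<longleftrightarrow> (\<forall>l\<in>subdifferential g z. l \<bullet> d \<le> \<tau>)"
proof -
  have conv: "convex (epi g)"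
    using poly by (simp add: polyhedral_fun_def polyhedron_imp_convex)
  note sub = subdifferential_convex[OF conv, of _ z, unfolded gz, simplified]
  obtain F where F: "finite F" "epi g = \<Inter>F" "\<forall>h\<in>F. \<exists>a b. a \<noteq> 0 \<and> h = {x. a \<bullet> x \<le> b}"
    using poly by (auto simp: polyhedral_fun_def polyhedron_def)
  then obtain a b where ab: "\<And>h. h \<in> F \<Longrightarrow> h = {x. a h \<bullet> x \<le> b h}"
    by metis
  define p where "p h = fst (a h)" for h
  define q where "q h = snd (a h)" for h
  have epi_iff: "g x \<le> ereal \<alpha> \<longleftrightarrow> (\<forall>h\<in>F. p h \<bullet> x + q h * \<alpha> \<le> b h)" for x \<alpha>
  proof -
    have "g x \<le> ereal \<alpha> \<longleftrightarrow> (x, \<alpha>) \<in> \<Inter>F"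
      using F(2) by (auto simp: epi_def)
    also have "\<dots> \<longleftrightarrow> (\<forall>h\<in>F. (x, \<alpha>) \<in> {x. a h \<bullet> x \<le> b h})"
      using ab by blast
    finally show ?thesis
      by (simp add: inner_prod_def p_def q_def)
  qed
  have y0: "p h \<bullet> z + q h * \<gamma> \<le> b h" if "h \<in> F" for h
    using epi_iff[of z \<gamma>] gz that by auto
  \<comment> \<open>The epigraph is closed upwards. If \<open>q h\<close> were positive, raising
    \<open>(z, \<gamma>)\<close> by \<open>n\<close> would overshoot the bound \<open>b h\<close> by
    exactly \<open>q h\<close>.\<close>
  have q: "q h \<le> 0" if h: "h \<in> F" for h
  proof (rule ccontr)
    assume "\<not> q h \<le> 0"
    then have qp: "q h > 0" by simp
    define n where "n = (b h - p h \<bullet> z - q h * \<gamma>) / q h + 1"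
    have "n \<ge> 0" using y0[OF h] qp by (simp add: n_def)
    then have "p h \<bullet> z + q h * (\<gamma> + n) \<le> b h"
      using epi_iff[of z "\<gamma> + n"] gz h by auto
    moreover have "q h * n = b h - p h \<bullet> z - q h * \<gamma> + q h"
      using qp by (simp add: n_def field_simps)
    ultimately show False using qp by (simp add: algebra_simps)
  qed
  have "\<forall>\<^sub>F d::'a in nhds 0. \<forall>h\<in>F. p h \<bullet> z + q h * \<gamma> < b h \<longrightarrow>
      (norm (p h) + \<bar>q h\<bar> * norm l0) * norm d < b h - (p h \<bullet> z + q h * \<gamma>)"
  proof (intro eventually_ball_finite F(1) ballI)
    fix h
    define K where "K = norm (p h) + \<bar>q h\<bar> * norm l0"
    have K: "K \<ge> 0" by (simp add: K_def)
    have "\<forall>\<^sub>F d::'a in nhds 0. K * norm d < c" if "c > 0" for c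
      unfolding eventually_nhds_metric
    proof (intro exI[of _ "c / (K + 1)"] conjI allI impI)
      fix d :: 'a assume "dist d 0 < c / (K + 1)"
      then have "(K + 1) * norm d < c" using K by (simp add: field_simps)
      then show "K * norm d < c" using norm_ge_zero[of d] unfolding distrib_right by linarith
    qed (use K that in auto)
    then show "\<forall>\<^sub>F d::'a in nhds 0. p h \<bullet> z + q h * \<gamma> < b h \<longrightarrow>
      (norm (p h) + \<bar>q h\<bar> * norm l0) * norm d < b h - (p h \<bullet> z + q h * \<gamma>)"
      unfolding K_def by (cases "p h \<bullet> z + q h * \<gamma> < b h") auto
  qed
  \<comment> \<open>Inactive half-spaces remain satisfied within this radius: \<open>q h\<close> is
    nonpositive and \<open>\<tau>\<close> is at least \<open>l0 . d\<close>, so the left side grows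
    by at most the displayed multiple of \<open>norm d\<close>.\<close>
  then obtain \<epsilon> where eps: "\<epsilon> > 0" "\<And>(d::'a) h. norm d < \<epsilon> \<Longrightarrow> h \<in> F \<Longrightarrow> p h \<bullet> z + q h * \<gamma> < b h \<Longrightarrow>
      (norm (p h) + \<bar>q h\<bar> * norm l0) * norm d < b h - (p h \<bullet> z + q h * \<gamma>)"
    unfolding eventually_nhds_metric by (auto simp: dist_norm)
  have "g (z + d) \<le> ereal (\<gamma> + \<tau>)"
    if d: "norm d < \<epsilon>" and \<tau>: "\<And>l. l \<in> subdifferential g z \<Longrightarrow> l \<bullet> d \<le> \<tau>" for d \<tau>
    unfolding epi_iff
  proof
    fix h assume h: "h \<in> F"
    consider "p h \<bullet> z + q h * \<gamma> < b h" | "p h \<bullet> z + q h * \<gamma> = b h"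
      using y0[OF h] by linarith
    then show "p h \<bullet> (z + d) + q h * (\<gamma> + \<tau>) \<le> b h"
    proof cases
      case 1
      have "q h * \<tau> \<le> q h * (l0 \<bullet> d)"
        using \<tau>[OF l0] q[OF h] by (rule mult_left_mono_neg)
      also have "\<dots> \<le> \<bar>q h\<bar> * (norm l0 * norm d)"
        using Cauchy_Schwarz_ineq2[of l0 d] by (metis abs_ge_self abs_ge_zero abs_mult mult_left_mono order_trans)
      finally have "p h \<bullet> d + q h * \<tau> \<le> (norm (p h) + \<bar>q h\<bar> * norm l0) * norm d"
        using norm_cauchy_schwarz[of "p h" d] by (simp add: algebra_simps)
      then show ?thesis
        using eps(2)[OF d h 1] by (simp add: algebra_simps)
    next
      case 2
      \<comment> \<open>A non-vertical active half-space yields a subgradient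
        \<open>p h / (- q h)\<close>, a vertical one only a recession direction. Mixing with
        \<open>\<kappa> * l0\<close> turns both cases into a genuine subgradient \<open>l1\<close>;
        the extra term disappears as \<open>\<kappa>\<close> tends to 0.\<close>
      have le: "p h \<bullet> d + q h * \<tau> \<le> \<kappa> * (\<tau> - l0 \<bullet> d)" if \<kappa>: "\<kappa> > 0" for \<kappa>
      proof -
        have pos: "\<kappa> - q h > 0" using \<kappa> q[OF h] by linarith
        define l1 where "l1 = (1 / (\<kappa> - q h)) *\<^sub>R (p h + \<kappa> *\<^sub>R l0)"
        have l1: "(\<kappa> - q h) * (l1 \<bullet> e) = p h \<bullet> e + \<kappa> * (l0 \<bullet> e)" for e
          using pos by (simp add: l1_def inner_add_left)
        have "l1 \<in> subdifferential g z"
          unfolding sub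
        proof (intro allI impI)
          fix z' \<alpha> assume *: "g z' \<le> ereal \<alpha>"
          have "p h \<bullet> z' + q h * \<alpha> \<le> p h \<bullet> z + q h * \<gamma>"
            using * epi_iff h 2 by auto
          moreover have "\<kappa> * (\<gamma> + l0 \<bullet> (z' - z)) \<le> \<kappa> * \<alpha>"
            using l0 * \<kappa> unfolding sub by simp
          ultimately have "(\<kappa> - q h) * (\<gamma> + l1 \<bullet> (z' - z)) \<le> (\<kappa> - q h) * \<alpha>"
            unfolding distrib_left l1 by (simp add: algebra_simps)
          then show "\<gamma> + l1 \<bullet> (z' - z) \<le> \<alpha>" using pos by simp
        qed
        from \<tau>[OF this] have "(\<kappa> - q h) * (l1 \<bullet> d) \<le> (\<kappa> - q h) * \<tau>"
          using pos by simp
        then show ?thesis unfolding l1 by (simp add: algebra_simps)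
      qed
      have "p h \<bullet> d + q h * \<tau> \<le> 0"
      proof (rule field_le_epsilon)
        fix e :: real assume e: "e > 0"
        have nn: "\<tau> - l0 \<bullet> d \<ge> 0" using \<tau>[OF l0] by simp
        have "p h \<bullet> d + q h * \<tau> \<le> e / (\<tau> - l0 \<bullet> d + 1) * (\<tau> - l0 \<bullet> d)"
          using e nn by (intro le) auto
        also have "\<dots> \<le> e" using e nn by (simp add: field_simps)
        finally show "p h \<bullet> d + q h * \<tau> \<le> 0 + e" by simp
      qed
      then show ?thesis using 2 by (simp add: algebra_simps)
    qed
  qed
  moreover have "l \<bullet> d \<le> \<tau>" if "g (z + d) \<le> ereal (\<gamma> + \<tau>)" "l \<in> subdifferential g z" for d \<tau> l
    using that(2) that(1) unfolding sub by fastforce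
  ultimately show ?thesis using that[OF eps(1)] by blast
qed

lemma affine_hull_add_span:
  assumes "l0 \<in> C" "l \<in> affine hull C" "s \<in> span ((\<lambda>x. x - l0) ` C)"
  shows "l + s \<in> affine hull C"
proof -
  have "(+) (- l0) = (\<lambda>x. x - l0)" by auto
  then have eq: "affine hull C = (+) l0 ` span ((\<lambda>x. x - l0) ` C)"
    using affine_hull_span_gen[of l0 C] assms(1) by (simp add: hull_inc)
  then show ?thesis
    using assms(2,3) by (auto simp: add.assoc intro!: imageI span_add)
qed

lemma diff_in_span_translate:
  assumes "l \<in> C" "m \<in> C"
  shows "l - m \<in> span ((\<lambda>x. x - l0) ` C)"
  using span_diff[of "l - l0" _ "m - l0"] assms by (simp add: span_base)

lemma rel_interior_span_ball:
  fixes C :: "'a::euclidean_space set"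
  assumes "l0 \<in> C" "l \<in> rel_interior C"
  obtains \<eta> where "\<eta> > 0" "\<And>s. s \<in> span ((\<lambda>x. x - l0) ` C) \<Longrightarrow> norm s < \<eta> \<Longrightarrow> l + s \<in> C"
proof -
  obtain \<eta> where \<eta>: "\<eta> > 0" "ball l \<eta> \<inter> affine hull C \<subseteq> C" and "l \<in> C"
    using assms(2) by (auto simp: mem_rel_interior_ball)
  then have "l \<in> affine hull C" by (simp add: hull_inc)
  then have "l + s \<in> C" if "s \<in> span ((\<lambda>x. x - l0) ` C)" "norm s < \<eta>" for s
    using affine_hull_add_span[OF assms(1) _ that(1)] that(2) \<eta>(2) by (auto simp: subset_iff dist_norm)
  with \<eta>(1) that show ?thesis by blast
qed

text \<open>Since \<open>g\<close> is locally a support function, a subgradient at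
  \<open>z + d\<close> is a point of the subdifferential at \<open>z\<close> that maximizes the
  pairing with \<open>d\<close>. Maximality comes from testing \<open>l\<close> at \<open>z\<close>;
  membership comes from testing it at \<open>z + d\<close> shifted slightly in the direction
  \<open>z' - z\<close>.\<close>

lemma subdifferential_near:
  fixes g :: "'a::euclidean_space \<Rightarrow> ereal"
  assumes conv: "convex (epi g)" and gz: "g z = ereal \<gamma>"
    and model: "\<forall>d \<tau>. norm d < \<epsilon> \<longrightarrow>
      (g (z + d) \<le> ereal (\<gamma> + \<tau>) \<longleftrightarrow> (\<forall>l\<in>subdifferential g z. l \<bullet> d \<le> \<tau>))"
    and l: "l \<in> subdifferential g (z + d)" and d: "norm d < \<epsilon>"
  shows "l \<in> subdifferential g z" "\<And>m. m \<in> subdifferential g z \<Longrightarrow> (m - l) \<bullet> d \<le> 0"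
proof -
  note sub = subdifferential_convex[OF conv, of _ z, unfolded gz, simplified]
  obtain t where t: "g (z + d) = ereal (\<gamma> + t)"
  proof -
    have "\<bar>g (z + d)\<bar> \<noteq> \<infinity>" using l by (simp add: subdifferential_def)
    then show ?thesis using that[of "real_of_ereal (g (z + d)) - \<gamma>"] by (simp add: ereal_real)
  qed
  have l': "\<gamma> + t + l \<bullet> (z' - (z + d)) \<le> \<alpha>" if "g z' \<le> ereal \<alpha>" for z' \<alpha>
    using l that unfolding subdifferential_convex[OF conv] t by auto
  have m: "m \<bullet> d \<le> t" if "m \<in> subdifferential g z" for m
    using model[rule_format, OF d, of t] t that by auto
  have "t \<le> l \<bullet> d" using l'[of z \<gamma>] gz by (simp add: inner_diff_right inner_add_right)
  then show "(m - l) \<bullet> d \<le> 0" if "m \<in> subdifferential g z" for m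
    using m[OF that] by (simp add: inner_diff_left)
  show "l \<in> subdifferential g z"
    unfolding sub
  proof (intro allI impI)
    fix z' \<alpha> assume z': "g z' \<le> ereal \<alpha>"
    define e where "e = z' - z"
    \<comment> \<open>The step uses at most half of the remaining room
      \<open>\<epsilon> - norm d\<close>, so the shifted point stays where the local model
      holds.\<close>
    define \<theta> where "\<theta> = (\<epsilon> - norm d) / (2 * (norm e + 1))"
    have ne: "norm e + 1 > 0" by (simp add: add_nonneg_pos)
    have \<theta>: "\<theta> > 0" using d ne by (simp add: \<theta>_def)
    have "\<theta> * norm e \<le> \<theta> * (norm e + 1)" using \<theta> by simp
    also have "\<dots> = (\<epsilon> - norm d) / 2" using ne by (simp add: \<theta>_def field_simps)
    finally have "norm (d + \<theta> *\<^sub>R e) < \<epsilon>"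
      using d \<theta> norm_triangle_ineq[of d "\<theta> *\<^sub>R e"] by simp
    moreover have "m \<bullet> (d + \<theta> *\<^sub>R e) \<le> t + \<theta> * (\<alpha> - \<gamma>)" if "m \<in> subdifferential g z" for m
    proof -
      have "m \<bullet> e \<le> \<alpha> - \<gamma>" using that z' unfolding sub e_def by force
      then show ?thesis using m[OF that] \<theta> by (simp add: inner_add_right add_mono)
    qed
    ultimately have "g (z + (d + \<theta> *\<^sub>R e)) \<le> ereal (\<gamma> + (t + \<theta> * (\<alpha> - \<gamma>)))"
      using model by blast
    from l'[OF this] have "\<theta> * (l \<bullet> e) \<le> \<theta> * (\<alpha> - \<gamma>)"
      by (simp add: algebra_simps)
    then show "\<gamma> + l \<bullet> (z' - z) \<le> \<alpha>" using \<theta> by (simp add: e_def)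
  qed
qed

text \<open>This is what makes SOQC usable. If \<open>l\<close> is relatively interior, nearby graph
  points \<open>(z + d, l + e)\<close> have \<open>d\<close> orthogonal to the direction space,
  because \<open>l + e\<close> is relatively interior too and maximizes the pairing with
  \<open>d\<close>. So \<open>(s, 0)\<close> is a regular normal there, and density of the relative
  interior carries it to \<open>l0\<close> as a limiting normal.\<close>

lemma coderivative_subdifferential_polyhedral:
  fixes g :: "'a::euclidean_space \<Rightarrow> ereal"
  assumes poly: "polyhedral_fun g" and gz: "g z = ereal \<gamma>" and l0: "l0 \<in> subdifferential g z"
    and s: "s \<in> span ((\<lambda>l. l - l0) ` subdifferential g z)"
  shows "s \<in> coderivative (subdifferential g) z l0 0"
proof -
  let ?C = "subdifferential g z"
  have conv: "convex (epi g)"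
    using poly by (simp add: polyhedral_fun_def polyhedron_imp_convex)
  obtain \<epsilon> where eps: "\<epsilon> > 0" "\<forall>d \<tau>. norm d < \<epsilon> \<longrightarrow>
      (g (z + d) \<le> ereal (\<gamma> + \<tau>) \<longleftrightarrow> (\<forall>l\<in>?C. l \<bullet> d \<le> \<tau>))"
    using polyhedral_local_model[OF poly gz l0] by metis
  note near = subdifferential_near[OF conv gz eps(2)]
  have reg: "(s, 0) \<in> regular_normal_cone (gph (subdifferential g)) (z, l)"
    if l: "l \<in> rel_interior ?C" for l
    unfolding regular_normal_cone_def polar_cone_def tangent_cone_def
  proof clarsimp
    fix w1 w2 t u
    assume t: "\<forall>k. 0 < t k" "t \<longlonglongrightarrow> 0" and u: "u \<longlonglongrightarrow> (w1, w2)"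
      and G: "\<forall>k. (z, l) + t k *\<^sub>R u k \<in> gph (subdifferential g)"
    obtain \<eta> where \<eta>: "\<eta> > 0" "\<And>s. s \<in> span ((\<lambda>x. x - l0) ` ?C) \<Longrightarrow> norm s < \<eta> \<Longrightarrow> l + s \<in> ?C"
      using rel_interior_span_ball[OF l0 l] by blast
    have lC: "l \<in> ?C" using l rel_interior_subset by blast
    \<comment> \<open>Half of \<open>\<eta>\<close> is reserved for \<open>c s\<close> and half for
      the displacement \<open>e\<close> of the multiplier.\<close>
    define c where "c = \<eta> / (2 * (norm s + 1))"
    have ns: "norm s + 1 > 0" by (simp add: add_nonneg_pos)
    have c: "c > 0" using \<eta> ns by (simp add: c_def)
    have "c * norm s \<le> c * (norm s + 1)" using c by simp
    also have "\<dots> = \<eta> / 2" using ns by (simp add: c_def field_simps)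
    finally have cs: "norm (c *\<^sub>R s) \<le> \<eta> / 2" using c by simp
    have f: "(\<lambda>k. fst (u k)) \<longlonglongrightarrow> w1" and g: "(\<lambda>k. snd (u k)) \<longlonglongrightarrow> w2"
      using tendsto_fst[OF u] tendsto_snd[OF u] by simp_all
    have 1: "\<forall>\<^sub>F k in sequentially. norm (t k *\<^sub>R fst (u k)) < \<epsilon>"
      using tendsto_norm[OF tendsto_scaleR[OF t(2) f]] eps(1)
      by (intro order_tendstoD(2)[of _ 0]) auto
    have 2: "\<forall>\<^sub>F k in sequentially. norm (t k *\<^sub>R snd (u k)) < \<eta> / 2"
      using tendsto_norm[OF tendsto_scaleR[OF t(2) g]] \<eta>(1)
      by (intro order_tendstoD(2)[of _ 0]) auto
    have ev: "\<forall>\<^sub>F k in sequentially. s \<bullet> fst (u k) = 0"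
      using 1 2
    proof eventually_elim
      case (elim k)
      define d where "d = t k *\<^sub>R fst (u k)"
      define e where "e = t k *\<^sub>R snd (u k)"
      have "l + e \<in> subdifferential g (z + d)"
        using G[rule_format, of k] by (auto simp: gph_def d_def e_def plus_prod_def)
      note n = near[OF this elim(1)[folded d_def]]
      have eS: "e \<in> span ((\<lambda>x. x - l0) ` ?C)"
        using diff_in_span_translate[OF n(1) lC, of l0] by simp
      \<comment> \<open>Both signs of \<open>s\<close> are admissible perturbations, which turns the
        inequality into orthogonality.\<close>
      have "sg *\<^sub>R s \<bullet> d \<le> 0" if sg: "\<bar>sg\<bar> = 1" for sg
      proof -
        have "norm (e + (sg * c) *\<^sub>R s) < \<eta>"
          using elim(2) cs sg c norm_triangle_ineq[of e "(sg * c) *\<^sub>R s"] by (simp add: e_def abs_mult)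
        then have "l + (e + (sg * c) *\<^sub>R s) \<in> ?C"
          using eS s by (intro \<eta>(2) span_add span_scale)
        from n(2)[OF this] have "c * (sg *\<^sub>R s \<bullet> d) \<le> 0"
          by (simp add: algebra_simps)
        then show ?thesis using c by (simp add: mult_le_0_iff)
      qed
      from this[of 1] this[of "-1"] have "s \<bullet> d = 0" by simp
      then show ?case using t(1)[rule_format, of k] by (simp add: d_def)
    qed
    have "(\<lambda>k. s \<bullet> fst (u k)) \<longlonglongrightarrow> s \<bullet> w1"
      by (intro tendsto_intros f)
    then have "s \<bullet> w1 = 0"
      using ev tendsto_cong[OF ev] LIMSEQ_unique tendsto_const by blast
    then show "s \<bullet> w1 \<le> 0" by simp
  qed
  have "l0 \<in> closure (rel_interior ?C)"
    using convex_closure_rel_interior[OF convex_subdifferential[OF conv, of z]] l0 closure_subset by blast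
  then obtain y where y: "\<And>k. y k \<in> rel_interior ?C" "y \<longlonglongrightarrow> l0"
    using closure_sequential by blast
  have "(s, - 0) \<in> normal_cone (gph (subdifferential g)) (z, l0)"
    unfolding normal_cone_def
  proof (intro CollectI exI conjI allI)
    show "(z, y k) \<in> gph (subdifferential g)" for k
      using y(1) rel_interior_subset by (auto simp: gph_def)
    show "(\<lambda>k. (z, y k)) \<longlonglongrightarrow> (z, l0)" by (intro tendsto_intros y)
    show "(s, - 0) \<in> regular_normal_cone (gph (subdifferential g)) (z, y k)" for k
      using reg[OF y(1)] by simp
  qed simp
  then show ?thesis by (simp add: coderivative_def)
qed

section \<open>Nondegenerate compositions\<close>

text \<open>The adjoint is written in coordinates, so that it is visibly bilinear in the operator
  and the vector; the product rule then differentiates expressions such as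
  \<open>adj (D x) l\<close> in \<open>x\<close>.\<close>

definition adj :: "('a::euclidean_space \<Rightarrow>\<^sub>L 'b::real_inner) \<Rightarrow> 'b \<Rightarrow> 'a" where
  "adj X l = (\<Sum>b\<in>Basis. (l \<bullet> blinfun_apply X b) *\<^sub>R b)"

lemma inner_adj: "adj X l \<bullet> h = l \<bullet> blinfun_apply X h"
proof -
  have "blinfun_apply X h = blinfun_apply X (\<Sum>b\<in>Basis. (h \<bullet> b) *\<^sub>R b)"
    by (simp add: euclidean_representation)
  also have "\<dots> = (\<Sum>b\<in>Basis. (h \<bullet> b) *\<^sub>R blinfun_apply X b)"
    by (simp add: blinfun.sum_right blinfun.scaleR_right)
  finally show ?thesis
    by (simp add: adj_def inner_sum_left inner_sum_right inner_commute mult.commute)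
qed

lemma norm_adj: "norm (adj X l) \<le> norm X * norm l"
proof (cases "adj X l = 0")
  case False
  have "norm (adj X l) * norm (adj X l) = l \<bullet> blinfun_apply X (adj X l)"
    by (simp add: norm_eq_sqrt_inner flip: inner_adj)
  also have "\<dots> \<le> norm l * (norm X * norm (adj X l))"
    by (meson mult_left_mono norm_blinfun norm_cauchy_schwarz norm_ge_zero order_trans)
  finally show ?thesis using False by (simp add: algebra_simps)
qed simp

lemma bounded_bilinear_adj: "bounded_bilinear adj"
proof
  show "\<exists>K. \<forall>a b. norm (adj a b) \<le> norm a * norm b * K"
    using norm_adj by (metis mult.right_neutral)
qed (simp_all add: adj_def blinfun.add_left blinfun.scaleR_left inner_add_left inner_add_right
    scaleR_add_left sum.distrib scaleR_sum_right)

interpretation adj: bounded_bilinear adj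
  by (rule bounded_bilinear_adj)

section \<open>The setting: a support function composed with a smooth map\<close>

text \<open>The outer function enters only through \<open>C\<close>: by \<open>model\<close>,
  \<open>\<phi>\<close> near \<open>x0\<close> is \<open>\<gamma>\<close> plus the support function
  of \<open>C\<close> at \<open>\<Phi> x - \<Phi> x0\<close>, expressed by real upper bounds.
  \<open>P\<close> is the orthogonal projection onto the direction space \<open>S\<close>, and
  \<open>inj\<close> is the form in which SOQC is used.\<close>

locale nondegenerate_composition =
  fixes \<phi> :: "'a::euclidean_space \<Rightarrow> ereal" and \<Phi> :: "'a \<Rightarrow> 'b::euclidean_space"
    and D :: "'a \<Rightarrow> 'a \<Rightarrow>\<^sub>L 'b" and D2 :: "'a \<Rightarrow> 'a \<Rightarrow>\<^sub>L ('a \<Rightarrow>\<^sub>L 'b)"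
    and U :: "'a set" and x0 :: 'a and C :: "'b set" and l0 :: 'b and \<gamma> :: real
    and P :: "'b \<Rightarrow> 'b" and S :: "'b set"
  assumes U: "open U" "x0 \<in> U"
    and D: "\<And>x. x \<in> U \<Longrightarrow> (\<Phi> has_derivative blinfun_apply (D x)) (at x)"
    and D2: "\<And>x. x \<in> U \<Longrightarrow> (D has_derivative blinfun_apply (D2 x)) (at x)" "continuous_on U D2"
    and C: "closed C" "convex C" "l0 \<in> C"
    and S_def: "S = span ((\<lambda>l. l - l0) ` C)"
    and P: "bounded_linear P" "\<And>x. P x \<in> S" "\<And>s x. s \<in> S \<Longrightarrow> s \<bullet> P x = s \<bullet> x"
      "\<And>s. s \<in> S \<Longrightarrow> P s = s"
    and model: "\<And>x \<tau>. x \<in> U \<Longrightarrow>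
      \<phi> x \<le> ereal (\<gamma> + \<tau>) \<longleftrightarrow> (\<forall>l\<in>C. l \<bullet> (\<Phi> x - \<Phi> x0) \<le> \<tau>)"
    and inj: "\<And>s. s \<in> S \<Longrightarrow> adj (D x0) s = 0 \<Longrightarrow> s = 0"
    and pb: "prox_bounded \<phi>"
begin

interpretation P: bounded_linear P by (rule P(1))

lemma P_P [simp]: "P (P x) = P x"
  using P(2,4) by blast

lemma diff_in_S: "l \<in> C \<Longrightarrow> m \<in> C \<Longrightarrow> l - m \<in> S"
  unfolding S_def by (rule diff_in_span_translate)

lemma phi_ge: "x \<in> U \<Longrightarrow> l \<in> C \<Longrightarrow> ereal (\<gamma> + l \<bullet> (\<Phi> x - \<Phi> x0)) \<le> \<phi> x"
proof (rule ereal_le_real)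
  fix z assume *: "x \<in> U" "l \<in> C" "\<phi> x \<le> ereal z"
  then show "ereal (\<gamma> + l \<bullet> (\<Phi> x - \<Phi> x0)) \<le> ereal z"
    using model[of x "z - \<gamma>"] by force
qed

lemma phi_eq:
  assumes "x \<in> U" "l \<in> C" "\<And>m. m \<in> C \<Longrightarrow> (m - l) \<bullet> (\<Phi> x - \<Phi> x0) \<le> 0"
  shows "\<phi> x = ereal (\<gamma> + l \<bullet> (\<Phi> x - \<Phi> x0))"
  using phi_ge[OF assms(1,2)] model[OF assms(1), of "l \<bullet> (\<Phi> x - \<Phi> x0)"] assms(3)
  by (auto simp: inner_diff_left intro: antisym)

lemma phi_x0: "\<phi> x0 = ereal \<gamma>"
  using phi_eq[OF U(2) C(3)] by simp

lemma isCont_D: "x \<in> U \<Longrightarrow> isCont D x"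
  using D2(1) has_derivative_continuous by blast

section \<open>Taylor estimates and uniform quadratic minorization\<close>

lemma taylor_bound:
  obtains \<eta> M K where "\<eta> > 0" "M \<ge> 0" "K \<ge> 0" "cball x0 \<eta> \<subseteq> U"
    "\<And>x. x \<in> cball x0 \<eta> \<Longrightarrow> norm (D x) \<le> K"
    "\<And>x y. x \<in> cball x0 \<eta> \<Longrightarrow> y \<in> cball x0 \<eta> \<Longrightarrow> norm (\<Phi> y - \<Phi> x) \<le> K * norm (y - x)"
    "\<And>x y. x \<in> cball x0 \<eta> \<Longrightarrow> y \<in> cball x0 \<eta> \<Longrightarrow>
      norm (\<Phi> y - \<Phi> x - D x (y - x)) \<le> M * (norm (y - x))\<^sup>2"
proof -
  obtain \<eta> where \<eta>: "\<eta> > 0" "cball x0 \<eta> \<subseteq> U"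
    using U open_contains_cball by blast
  let ?B = "cball x0 \<eta>"
  have "compact (D2 ` ?B)"
    using D2(2) \<eta>(2) by (intro compact_continuous_image) (auto intro: continuous_on_subset)
  then obtain M where M: "\<And>x. x \<in> ?B \<Longrightarrow> norm (D2 x) \<le> M"
    by (meson bounded_iff compact_imp_bounded image_eqI)
  have "continuous_on ?B D"
    using isCont_D \<eta>(2) by (meson continuous_at_imp_continuous_on subsetD)
  then have "compact (D ` ?B)"
    by (intro compact_continuous_image) auto
  then obtain K where K: "\<And>x. x \<in> ?B \<Longrightarrow> norm (D x) \<le> K"
    by (meson bounded_iff compact_imp_bounded image_eqI)
  have MK: "M \<ge> 0" "K \<ge> 0"
    using M[of x0] K[of x0] \<eta>(1) norm_ge_zero order_trans by (metis centre_in_cball less_imp_le)+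
  have lip: "norm (D y - D x) \<le> M * norm (y - x)" if "x \<in> ?B" "y \<in> ?B" for x y
    using that \<eta>(2) M
    by (intro differentiable_bound[where S = ?B and f' = "\<lambda>x. blinfun_apply (D2 x)"])
       (auto intro!: has_derivative_at_withinI[OF D2(1)] simp: norm_blinfun.rep_eq)
  have 1: "norm (\<Phi> y - \<Phi> x) \<le> K * norm (y - x)" if "x \<in> ?B" "y \<in> ?B" for x y
    using that \<eta>(2) K
    by (intro differentiable_bound[where S = ?B and f' = "\<lambda>x. blinfun_apply (D x)"])
       (auto intro!: has_derivative_at_withinI[OF D] simp: norm_blinfun.rep_eq)
  have 2: "norm (\<Phi> y - \<Phi> x - D x (y - x)) \<le> M * (norm (y - x))\<^sup>2" if xy: "x \<in> ?B" "y \<in> ?B" for x y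
  proof -
    have seg: "closed_segment x y \<subseteq> ?B"
      using xy by (meson closed_segment_subset convex_cball)
    have "norm (\<Phi> y - \<Phi> x - D x (y - x)) \<le> norm (y - x) * (M * norm (y - x))"
    proof (rule differentiable_bound_linearization[where S = "closed_segment x y"])
      show "x + t *\<^sub>R (y - x) \<in> closed_segment x y" if "t \<in> {0..1}" for t
        using that by (auto simp: in_segment algebra_simps)
      show "(\<Phi> has_derivative blinfun_apply (D z)) (at z within closed_segment x y)"
        if "z \<in> closed_segment x y" for z
        using D that seg \<eta>(2) by (meson has_derivative_at_withinI subsetD)
      show "onorm (blinfun_apply (D z) - blinfun_apply (D x)) \<le> M * norm (y - x)"
        if z: "z \<in> closed_segment x y" for z
      proof -
        have "blinfun_apply (D z) - blinfun_apply (D x) = blinfun_apply (D z - D x)"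
          by (simp add: blinfun.diff_left fun_eq_iff)
        then have "onorm (blinfun_apply (D z) - blinfun_apply (D x)) = norm (D z - D x)"
          by (simp add: norm_blinfun.rep_eq)
        also have "\<dots> \<le> M * norm (z - x)" using lip xy z seg by blast
        also have "\<dots> \<le> M * norm (y - x)"
          using segment_bound1[OF z] MK by (intro mult_left_mono) (auto simp: norm_minus_commute)
        finally show ?thesis .
      qed
    qed simp
    then show ?thesis by (simp add: power2_eq_square algebra_simps)
  qed
  show ?thesis using that[OF \<eta>(1) MK \<eta>(2) K 1 2] by blast
qed

text \<open>Near \<open>x0\<close> the support-function bound and Taylor expansion leave a quadratic
  error. Far away \<open>norm (y - w)\<close> is at least \<open>\<eta>\<close>, so constants and
  linear terms are dominated by its square, and prox-boundedness supplies the lower bound. One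
  constant serves all base points and multipliers considered.\<close>

lemma uniform_minorant:
  obtains \<rho> \<eta> where "\<rho> > 0" "\<eta> > 0" "ball x0 \<eta> \<subseteq> U"
    "\<And>w l y. \<lbrakk>w \<in> ball x0 \<eta>; l \<in> C; norm (l - l0) \<le> 1;
        \<And>m. m \<in> C \<Longrightarrow> (m - l) \<bullet> (\<Phi> w - \<Phi> x0) \<le> 0\<rbrakk> \<Longrightarrow>
      ereal (\<gamma> + l \<bullet> (\<Phi> w - \<Phi> x0) + adj (D w) l \<bullet> (y - w) - \<rho> / 2 * (norm (y - w))\<^sup>2) \<le> \<phi> y"
proof -
  obtain \<eta>2 M K where T: "\<eta>2 > 0" "M \<ge> 0" "K \<ge> 0" "cball x0 \<eta>2 \<subseteq> U"
    "\<And>x. x \<in> cball x0 \<eta>2 \<Longrightarrow> norm (D x) \<le> K"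
    "\<And>x y. x \<in> cball x0 \<eta>2 \<Longrightarrow> y \<in> cball x0 \<eta>2 \<Longrightarrow> norm (\<Phi> y - \<Phi> x) \<le> K * norm (y - x)"
    "\<And>x y. x \<in> cball x0 \<eta>2 \<Longrightarrow> y \<in> cball x0 \<eta>2 \<Longrightarrow>
      norm (\<Phi> y - \<Phi> x - D x (y - x)) \<le> M * (norm (y - x))\<^sup>2"
    using taylor_bound by metis
  obtain \<alpha> \<beta> where ab: "\<And>x. ereal \<beta> \<le> \<phi> x + ereal (\<alpha> * (norm x)\<^sup>2)"
    using pb by (auto simp: prox_bounded_def)
  \<comment> \<open>Halving the Taylor radius keeps every \<open>y\<close> outside the large ball at
    distance at least \<open>\<eta>\<close> from \<open>w\<close>.\<close>
  define \<eta> where "\<eta> = \<eta>2 / 2"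
  have \<eta>: "\<eta> > 0" "\<eta> < \<eta>2" using T(1) by (auto simp: \<eta>_def)
  define L where "L = norm l0 + 1"
  define k1 where "k1 = 1 + (norm x0 + \<eta>) / \<eta>"
  have L: "L > 0" unfolding L_def by (simp add: add_nonneg_pos)
  \<comment> \<open>One summand per error: Taylor remainder, \<open>\<beta>\<close>, the term with
    \<open>\<alpha>\<close> (where \<open>k1\<close> bounds \<open>norm y\<close> by a multiple of
    \<open>norm (y - w)\<close>), the constants, and the linear term; the final 1 gives
    positivity.\<close>
  define R where "R = L * M + \<bar>\<beta>\<bar> / \<eta>\<^sup>2 + \<bar>\<alpha>\<bar> * k1\<^sup>2 + (\<bar>\<gamma>\<bar> + L * K * \<eta>) / \<eta>\<^sup>2 + L * K / \<eta> + 1"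
  have terms: "0 \<le> L * M" "0 \<le> \<bar>\<beta>\<bar> / \<eta>\<^sup>2" "0 \<le> \<bar>\<alpha>\<bar> * k1\<^sup>2" "0 \<le> (\<bar>\<gamma>\<bar> + L * K * \<eta>) / \<eta>\<^sup>2" "0 \<le> L * K / \<eta>"
    using L T(2,3) \<eta>(1) by simp_all
  have bound: "ereal (\<gamma> + l \<bullet> (\<Phi> w - \<Phi> x0) + adj (D w) l \<bullet> (y - w) - R * (norm (y - w))\<^sup>2) \<le> \<phi> y"
    if w: "w \<in> ball x0 \<eta>" and l: "l \<in> C" "norm (l - l0) \<le> 1" for w l y
  proof -
    have w2: "w \<in> cball x0 \<eta>2" using w \<eta>(2) by auto
    have x02: "x0 \<in> cball x0 \<eta>2" using T(1) by simp
    have lL: "norm l \<le> L"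
      using l(2) norm_triangle_sub[of l l0] by (simp add: L_def)
    define N where "N = norm (y - w)"
    show ?thesis
    proof (cases "y \<in> cball x0 \<eta>2")
      case True
      define e where "e = \<Phi> y - \<Phi> w - D w (y - w)"
      have "- (l \<bullet> e) \<le> norm l * norm e"
        using Cauchy_Schwarz_ineq2[of l e] by (simp add: abs_le_iff)
      also have "\<dots> \<le> L * (M * N\<^sup>2)"
        using T(7)[OF w2 True] lL L by (intro mult_mono) (auto simp: e_def N_def)
      also have "\<dots> \<le> R * N\<^sup>2"
        unfolding mult.assoc[symmetric] using terms by (intro mult_right_mono) (auto simp: R_def)
      finally have "- (l \<bullet> e) \<le> R * N\<^sup>2" .
      moreover have "l \<bullet> (\<Phi> y - \<Phi> x0) = l \<bullet> (\<Phi> w - \<Phi> x0) + l \<bullet> D w (y - w) + l \<bullet> e"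
        by (simp add: e_def algebra_simps)
      ultimately have "ereal (\<gamma> + l \<bullet> (\<Phi> w - \<Phi> x0) + adj (D w) l \<bullet> (y - w) - R * N\<^sup>2)
          \<le> ereal (\<gamma> + l \<bullet> (\<Phi> y - \<Phi> x0))"
        by (simp add: inner_adj)
      also have "\<dots> \<le> \<phi> y" using phi_ge True T(4) l(1) by blast
      finally show ?thesis by (simp add: N_def)
    next
      case False
      have "norm (w - x0) < \<eta>" using w by (simp add: dist_norm norm_minus_commute)
      moreover have "norm (y - x0) > \<eta>2" using False by (simp add: dist_norm norm_minus_commute)
      moreover have "norm (y - x0) \<le> N + norm (w - x0)" unfolding N_def by norm
      ultimately have N: "N \<ge> \<eta>" by (simp add: \<eta>_def)
      have sq1: "1 \<le> N\<^sup>2 / \<eta>\<^sup>2" and lin1: "N \<le> N\<^sup>2 / \<eta>"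
        using N \<eta>(1) by (auto simp: divide_simps power2_eq_square intro: mult_mono)
      have A1: "l \<bullet> (\<Phi> w - \<Phi> x0) \<le> L * K * \<eta>"
      proof -
        have "norm (\<Phi> w - \<Phi> x0) \<le> K * norm (w - x0)" by (rule T(6)[OF x02 w2])
        also have "\<dots> \<le> K * \<eta>" using \<open>norm (w - x0) < \<eta>\<close> T(3) by (intro mult_left_mono) auto
        finally have "norm l * norm (\<Phi> w - \<Phi> x0) \<le> L * (K * \<eta>)"
          using lL L by (intro mult_mono) auto
        then show ?thesis using norm_cauchy_schwarz[of l "\<Phi> w - \<Phi> x0"] by simp
      qed
      have A2: "adj (D w) l \<bullet> (y - w) \<le> L * K * N"
      proof -
        have "norm (adj (D w) l) \<le> K * L"
          using norm_adj[of "D w" l] T(5)[OF w2] lL T(3) by (meson mult_mono norm_ge_zero order_trans)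
        then have "norm (adj (D w) l) * N \<le> K * L * N"
          by (intro mult_right_mono) (auto simp: N_def)
        then show ?thesis
          using norm_cauchy_schwarz[of "adj (D w) l" "y - w"] by (simp add: N_def mult.commute)
      qed
      have "norm y \<le> N + norm x0 + norm (w - x0)" unfolding N_def by norm
      also have "\<dots> \<le> N + (norm x0 + \<eta>)" using \<open>norm (w - x0) < \<eta>\<close> by simp
      also have "\<dots> \<le> N + (norm x0 + \<eta>) * (N / \<eta>)"
      proof -
        have "1 \<le> N / \<eta>" using N \<eta>(1) by simp
        then have "(norm x0 + \<eta>) * 1 \<le> (norm x0 + \<eta>) * (N / \<eta>)"
          using \<eta>(1) by (intro mult_left_mono) auto
        then show ?thesis by simp
      qed
      also have "\<dots> = k1 * N" by (simp add: k1_def algebra_simps add_divide_distrib)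
      finally have "(norm y)\<^sup>2 \<le> (k1 * N)\<^sup>2" by (intro power_mono) auto
      then have "\<bar>\<alpha>\<bar> * (norm y)\<^sup>2 \<le> \<bar>\<alpha>\<bar> * k1\<^sup>2 * N\<^sup>2"
        using mult_left_mono[of "(norm y)\<^sup>2" "(k1 * N)\<^sup>2" "\<bar>\<alpha>\<bar>"] by (simp add: power_mult_distrib mult.assoc)
      moreover have "\<alpha> * (norm y)\<^sup>2 \<le> \<bar>\<alpha>\<bar> * (norm y)\<^sup>2"
        by (intro mult_right_mono) auto
      ultimately have A3: "\<alpha> * (norm y)\<^sup>2 \<le> \<bar>\<alpha>\<bar> * k1\<^sup>2 * N\<^sup>2" by linarith
      have A4: "\<gamma> + L * K * \<eta> \<le> (\<bar>\<gamma>\<bar> + L * K * \<eta>) / \<eta>\<^sup>2 * N\<^sup>2"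
      proof -
        have "0 \<le> \<bar>\<gamma>\<bar> + L * K * \<eta>" using L T(3) \<eta>(1) by simp
        from mult_left_mono[OF sq1 this] show ?thesis by simp
      qed
      have A5: "L * K * N \<le> L * K / \<eta> * N\<^sup>2"
        using mult_left_mono[OF lin1, of "L * K"] L T(3) by simp
      have A6: "- \<beta> \<le> \<bar>\<beta>\<bar> / \<eta>\<^sup>2 * N\<^sup>2"
        using mult_left_mono[OF sq1, of "\<bar>\<beta>\<bar>"] by simp
      have A7: "0 \<le> L * M * N\<^sup>2" using terms(1) by simp
      have Req: "R * N\<^sup>2 = L * M * N\<^sup>2 + \<bar>\<beta>\<bar> / \<eta>\<^sup>2 * N\<^sup>2 + \<bar>\<alpha>\<bar> * k1\<^sup>2 * N\<^sup>2
          + (\<bar>\<gamma>\<bar> + L * K * \<eta>) / \<eta>\<^sup>2 * N\<^sup>2 + L * K / \<eta> * N\<^sup>2 + N\<^sup>2"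
        unfolding R_def by (simp only: distrib_right mult_1)
      have "\<gamma> + l \<bullet> (\<Phi> w - \<Phi> x0) + adj (D w) l \<bullet> (y - w) - R * N\<^sup>2 \<le> \<beta> - \<alpha> * (norm y)\<^sup>2"
        using A1 A2 A3 A4 A5 A6 A7 zero_le_power2[of N] unfolding Req by linarith
      then show ?thesis using ab[of y] by (cases "\<phi> y") (auto simp: N_def)
    qed
  qed
  show ?thesis
  proof (rule that[of "2 * R" \<eta>])
    show "2 * R > 0"
      unfolding R_def by (intro mult_pos_pos add_nonneg_pos add_nonneg_nonneg terms) simp_all
    show "ball x0 \<eta> \<subseteq> U" using T(4) \<eta>(2) by (meson ball_subset_cball less_imp_le subset_ball order_trans)
  qed (use \<eta>(1) bound in auto)
qed

section \<open>The optimality system and its local inverse\<close>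

text \<open>At \<open>kkt r (w, m) = (x, 0)\<close> the second component splits into \<open>P (\<Phi> w - \<Phi> x0) = 0\<close> and \<open>m \<in> S\<close>,
  and the first one reads \<open>(x - w) / r = adj (D w) (l0 + m)\<close>.\<close>

definition kkt :: "real \<Rightarrow> 'a \<times> 'b \<Rightarrow> 'a \<times> 'b" where
  "kkt r q = (fst q + r *\<^sub>R adj (D (fst q)) (l0 + P (snd q)),
    P (\<Phi> (fst q) - \<Phi> x0) + (snd q - P (snd q)))"

definition kkt' :: "real \<Rightarrow> 'a \<times> 'b \<Rightarrow> ('a \<times> 'b) \<Rightarrow>\<^sub>L ('a \<times> 'b)" where
  "kkt' r q = Blinfun (\<lambda>h.
    (fst h + r *\<^sub>R (adj (D (fst q)) (P (snd h)) + adj (D2 (fst q) (fst h)) (l0 + P (snd q))),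
     P (D (fst q) (fst h)) + (snd h - P (snd h))))"

lemma kkt'_apply:
  "blinfun_apply (kkt' r q) h =
    (fst h + r *\<^sub>R (adj (D (fst q)) (P (snd h)) + adj (D2 (fst q) (fst h)) (l0 + P (snd q))),
     P (D (fst q) (fst h)) + (snd h - P (snd h)))"
  unfolding kkt'_def
  by (subst bounded_linear_Blinfun_apply)
    (intro bounded_linear_Pair bounded_linear_add bounded_linear_sub bounded_linear_fst
      bounded_linear_snd bounded_linear_compose[OF bounded_linear_scaleR_right]
      bounded_linear_compose[OF P(1)] bounded_linear_compose[OF adj.bounded_linear_right]
      bounded_linear_compose[OF adj.bounded_linear_left]
      bounded_linear_compose[OF blinfun.bounded_linear_right], rule refl)

lemma kkt_has_derivative:
  assumes "fst q \<in> U"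
  shows "(kkt r has_derivative blinfun_apply (kkt' r q)) (at q)"
proof -
  have f: "(fst has_derivative fst) (at q)" and s: "(snd has_derivative snd) (at q)"
    by (auto intro!: derivative_eq_intros)
  have 1: "((\<lambda>q. D (fst q)) has_derivative (\<lambda>h. D2 (fst q) (fst h))) (at q)"
    by (rule has_derivative_compose[OF f D2(1)[OF assms]])
  have 2: "((\<lambda>q. \<Phi> (fst q)) has_derivative (\<lambda>h. D (fst q) (fst h))) (at q)"
    by (rule has_derivative_compose[OF f D[OF assms]])
  have 3: "((\<lambda>q. P (snd q)) has_derivative (\<lambda>h. P (snd h))) (at q)"
    by (rule P.has_derivative[OF s])
  have "(kkt r has_derivative (\<lambda>h.
    (fst h + r *\<^sub>R (adj (D (fst q)) (P (snd h)) + adj (D2 (fst q) (fst h)) (l0 + P (snd q))),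
     P (D (fst q) (fst h)) + (snd h - P (snd h))))) (at q)"
    unfolding kkt_def[abs_def]
    apply (rule has_derivative_Pair)
     apply (rule has_derivative_add[OF f])
     apply (rule has_derivative_scaleR_right)
     apply (rule adj.FDERIV[OF 1])
     apply (rule has_derivative_eq_rhs[OF has_derivative_add[OF has_derivative_const 3]])
     apply simp
    apply (rule has_derivative_add[OF _ has_derivative_diff[OF s 3]])
    apply (rule P.has_derivative)
    apply (rule has_derivative_eq_rhs[OF has_derivative_diff[OF 2 has_derivative_const]])
    apply simp
    done
  then show ?thesis by (simp add: kkt'_apply[abs_def])
qed

text \<open>In finite dimension, operator-norm convergence can be checked on each fixed
  vector.\<close>

lemma continuous_on_kkt': "continuous_on (U \<times> UNIV) (kkt' r)"
  unfolding continuous_on_def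
proof (intro ballI tendsto_componentwise1)
  fix q h assume q: "q \<in> U \<times> (UNIV :: 'b set)"
  let ?T = "at q within U \<times> UNIV"
  have f: "(fst \<longlongrightarrow> fst q) ?T" and s: "(snd \<longlongrightarrow> snd q) ?T"
    by (auto intro!: tendsto_eq_intros)
  have U': "fst q \<in> U" using q by auto
  have 1: "((\<lambda>q. D (fst q)) \<longlongrightarrow> D (fst q)) ?T"
    using isCont_tendsto_compose[OF isCont_D[OF U'] f] .
  have "isCont D2 (fst q)"
    using D2(2) U(1) U' continuous_on_eq_continuous_at by blast
  then have 2: "((\<lambda>q. D2 (fst q)) \<longlongrightarrow> D2 (fst q)) ?T"
    using isCont_tendsto_compose f by blast
  show "((\<lambda>y. blinfun_apply (kkt' r y) h) \<longlongrightarrow> blinfun_apply (kkt' r q) h) ?T"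
    unfolding kkt'_apply
    by (intro tendsto_intros adj.tendsto P.tendsto blinfun.tendsto 1 2 f s)
qed

text \<open>For \<open>(u, m)\<close> in the kernel, \<open>D x0 u\<close> is orthogonal to
  \<open>S\<close> and \<open>m\<close> lies in \<open>S\<close>. Pairing the first equation with
  \<open>u\<close> therefore removes the multiplier term and leaves a curvature term too small to
  balance \<open>u . u\<close>, so \<open>u = 0\<close>; then \<open>inj\<close> gives
  \<open>m = 0\<close>.\<close>

lemma kkt'_inj:
  assumes r: "r > 0" "r * (norm l0 * norm (D2 x0)) < 1" and 0: "kkt' r (x0, 0) h = 0"
  shows "h = 0"
proof -
  obtain u m where h: "h = (u, m)" by force
  have e1: "u + r *\<^sub>R (adj (D x0) (P m) + adj (D2 x0 u) l0) = 0"
    and e2: "P (D x0 u) + (m - P m) = 0"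
    using 0 by (simp_all add: h kkt'_apply P.zero zero_prod_def)
  have "P (P (D x0 u) + (m - P m)) = P (D x0 u)"
    by (simp add: P.add P.diff)
  then have PDu: "P (D x0 u) = 0" using e2 by (simp add: P.zero)
  then have m: "m = P m" using e2 by simp
  have "P m \<bullet> D x0 u = 0"
    using P(3)[OF P(2)[of m], of "D x0 u"] PDu by simp
  then have uu: "u \<bullet> u + r * (l0 \<bullet> D2 x0 u u) = 0"
    using arg_cong[OF e1, of "\<lambda>z. z \<bullet> u"] by (simp add: inner_add_left inner_adj)
  have "- (l0 \<bullet> D2 x0 u u) \<le> norm l0 * norm (D2 x0) * (norm u)\<^sup>2"
  proof -
    have "- (l0 \<bullet> D2 x0 u u) \<le> norm l0 * norm (D2 x0 u u)"
      using Cauchy_Schwarz_ineq2[of l0 "D2 x0 u u"] by (simp add: abs_le_iff)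
    also have "norm (D2 x0 u u) \<le> norm (D2 x0) * norm u * norm u"
      by (meson mult_right_mono norm_blinfun norm_ge_zero order_trans)
    finally show ?thesis by (simp add: mult_left_mono power2_eq_square mult.assoc)
  qed
  then have "r * (- (l0 \<bullet> D2 x0 u u)) \<le> r * (norm l0 * norm (D2 x0) * (norm u)\<^sup>2)"
    using r(1) by (intro mult_left_mono) auto
  moreover have "(norm u)\<^sup>2 = r * (- (l0 \<bullet> D2 x0 u u))"
    using uu by (simp add: power2_norm_eq_inner)
  ultimately have "(norm u)\<^sup>2 \<le> r * (norm l0 * norm (D2 x0) * (norm u)\<^sup>2)" by simp
  then have "(1 - r * (norm l0 * norm (D2 x0))) * (norm u)\<^sup>2 \<le> 0"
    by (simp add: algebra_simps)
  then have u: "u = 0"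
    using r(2) by (simp add: mult_le_0_iff)
  then have "adj (D x0) (P m) = 0"
    using e1 r(1) by (simp add: blinfun.zero_right adj.zero_left)
  then have "P m = 0" using inj[OF P(2)] by blast
  then show ?thesis using h u m by (simp add: zero_prod_def)
qed

lemma kkt_local_inverse:
  assumes r: "r > 0" "r * (norm l0 * norm (D2 x0)) < 1"
  obtains W V G where "open W" "W \<subseteq> U \<times> UNIV" "(x0, 0) \<in> W" "open V"
    "homeomorphism W V (kkt r) G" "C1_on V G"
    "\<And>q. q \<in> W \<Longrightarrow> (G has_derivative inv (blinfun_apply (kkt' r q))) (at (kkt r q))"
    "\<And>q. q \<in> W \<Longrightarrow> bij (blinfun_apply (kkt' r q))"
proof (rule inverse_function_theorem_C1[of "U \<times> UNIV" "(x0, 0)" "kkt r" "kkt' r"])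
  show "open (U \<times> (UNIV :: 'b set))" using U(1) by (simp add: open_Times)
  show "(x0, 0) \<in> U \<times> UNIV" using U(2) by simp
  show "(kkt r has_derivative blinfun_apply (kkt' r q)) (at q)" if "q \<in> U \<times> UNIV" for q
    using that by (intro kkt_has_derivative) auto
  show "h = 0" if "kkt' r (x0, 0) h = 0" for h
    using kkt'_inj[OF r that] .
  show "continuous_on (U \<times> UNIV) (kkt' r)" by (rule continuous_on_kkt')
qed (rule that)

lemma small_r_exists: obtains r where "r > 0" "r * (norm l0 * norm (D2 x0)) < 1"
proof
  let ?k = "norm l0 * norm (D2 x0)"
  have k: "?k \<ge> 0" by simp
  show "1 / (?k + 1) > 0" "1 / (?k + 1) * ?k < 1"
    using k by (auto simp: divide_simps add_nonneg_pos intro!: add_nonneg_pos)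
qed

text \<open>The linearized system is an injective endomorphism of a finite-dimensional space, hence
  onto; \<open>P\<close> of the second component of a solution for the right side
  \<open>(0, P d)\<close> gives the claim.\<close>

lemma derivative_onto: obtains u where "P (D x0 u) = P d"
proof -
  obtain r where r: "r > 0" "r * (norm l0 * norm (D2 x0)) < 1"
    by (rule small_r_exists)
  have "inj (blinfun_apply (kkt' r (x0, 0)))"
    using kkt'_inj[OF r] by (simp add: linear_injective_0 bounded_linear.linear blinfun.bounded_linear_right)
  then have "surj (blinfun_apply (kkt' r (x0, 0)))"
    by (intro linear_inj_imp_surj) (simp add: bounded_linear.linear blinfun.bounded_linear_right)
  then obtain h where "kkt' r (x0, 0) h = (0, P d)"
    by (metis surjD)
  then have "P (P (D x0 (fst h)) + (snd h - P (snd h))) = P (P d)"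
    by (simp add: kkt'_apply)
  then show ?thesis using that[of "fst h"] by (simp add: P.add P.diff)
qed

text \<open>Since \<open>P \<circ> \<Phi>\<close> is a submersion near \<open>x0\<close>, any direction is the velocity of a curve along
  which it moves on a straight line.\<close>

lemma straightening_curve:
  "\<forall>\<^sub>F x in nhds x0. x \<in> U \<and> (\<forall>u. \<exists>c. c 0 = x \<and> (c has_vector_derivative u) (at 0) \<and>
    (\<forall>\<^sub>F t in nhds 0. c t \<in> U \<and> P (\<Phi> (c t) - \<Phi> x) = t *\<^sub>R P (D x u)))"
proof -
  obtain r where r: "r > 0" "r * (norm l0 * norm (D2 x0)) < 1"
    by (rule small_r_exists)
  obtain W V G where W: "open W" "W \<subseteq> U \<times> UNIV" "(x0, 0) \<in> W" "open V"
    "homeomorphism W V (kkt r) G" "C1_on V G"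
    "\<And>q. q \<in> W \<Longrightarrow> (G has_derivative inv (blinfun_apply (kkt' r q))) (at (kkt r q))"
    "\<And>q. q \<in> W \<Longrightarrow> bij (blinfun_apply (kkt' r q))"
    using kkt_local_inverse[OF r] by metis
  have G: "kkt r q \<in> V" "G (kkt r q) = q" if "q \<in> W" for q
    using W(5) that by (auto simp: homeomorphism_def)
  have G': "G y \<in> W" "kkt r (G y) = y" if "y \<in> V" for y
    using W(5) that by (auto simp: homeomorphism_def)
  have "((\<lambda>x. (x, 0 :: 'b)) \<longlongrightarrow> (x0, 0)) (nhds x0)"
    by (intro tendsto_intros filterlim_ident)
  then have "\<forall>\<^sub>F x in nhds x0. (x, 0) \<in> W"
    using W(1,3) topological_tendstoD by blast
  then show ?thesis
  proof eventually_elim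
    case (elim x)
    let ?q = "(x, 0 :: 'b)"
    have "\<exists>c. c 0 = x \<and> (c has_vector_derivative u) (at 0) \<and>
      (\<forall>\<^sub>F t in nhds 0. c t \<in> U \<and> P (\<Phi> (c t) - \<Phi> x) = t *\<^sub>R P (D x u))" for u
    proof -
      \<comment> \<open>The curve is the preimage of a straight line in the range of
        \<open>kkt r\<close>, with the velocity that the linearization assigns to
        \<open>(u, 0)\<close>.\<close>
      define L where "L t = kkt r ?q + t *\<^sub>R kkt' r ?q (u, 0)" for t
      have L0: "L 0 = kkt r ?q" by (simp add: L_def)
      have "(L has_vector_derivative kkt' r ?q (u, 0)) (at 0)"
        unfolding L_def[abs_def] by (auto intro!: derivative_eq_intros)
      then have "((\<lambda>t. G (L t)) has_derivative (\<lambda>t. inv (blinfun_apply (kkt' r ?q)) (t *\<^sub>R kkt' r ?q (u, 0)))) (at 0)"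
        unfolding has_vector_derivative_def
        by (rule has_derivative_compose) (simp add: L0 W(7)[OF elim])
      then have "((\<lambda>t. G (L t)) has_derivative (\<lambda>t. t *\<^sub>R (u, 0))) (at 0)"
        using W(8)[OF elim] by (simp add: bij_is_inj flip: blinfun.scaleR_right)
      then have der: "((\<lambda>t. fst (G (L t))) has_vector_derivative u) (at 0)"
        unfolding has_vector_derivative_def by (drule_tac has_derivative_fst) simp
      have "(L \<longlongrightarrow> kkt r ?q + 0 *\<^sub>R kkt' r ?q (u, 0)) (nhds 0)"
        unfolding L_def[abs_def] by (intro tendsto_intros filterlim_ident)
      then have "\<forall>\<^sub>F t in nhds 0. L t \<in> V"
        using W(4) G(1)[OF elim] topological_tendstoD by fastforce
      then have "\<forall>\<^sub>F t in nhds 0. fst (G (L t)) \<in> U \<and> P (\<Phi> (fst (G (L t))) - \<Phi> x) = t *\<^sub>R P (D x u)"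
      proof eventually_elim
        case (elim t)
        \<comment> \<open>Applying \<open>P\<close> to the second component removes
          \<open>m - P m\<close> and leaves exact linear motion of the projected values.\<close>
        have "snd (kkt r (G (L t))) = snd (L t)" using G'(2)[OF elim] by simp
        then have "P (P (\<Phi> (fst (G (L t))) - \<Phi> x0) + (snd (G (L t)) - P (snd (G (L t))))) =
          P (P (\<Phi> x - \<Phi> x0) + t *\<^sub>R P (D x u))"
          by (simp add: kkt_def L_def kkt'_apply P.zero)
        then have "P (\<Phi> (fst (G (L t))) - \<Phi> x) = t *\<^sub>R P (D x u)"
          by (simp add: P.add P.diff P.scaleR algebra_simps)
        then show ?case using G'(1)[OF elim] W(2) by auto
      qed
      with der show ?thesis
        using G(2)[OF elim] L0 by (intro exI[of _ "\<lambda>t. fst (G (L t))"]) auto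
    qed
    then show ?case using elim W(2) by auto
  qed
qed

section \<open>The subdifferential of the composition\<close>

lemma x0_in_epi: "(x0, \<gamma>) \<in> epi \<phi>"
  by (simp add: epi_def phi_x0)

text \<open>The function \<open>\<gamma> + l . (\<Phi> x - \<Phi> x0)\<close> minorizes
  \<open>\<phi>\<close> near \<open>x0\<close> and touches it there, so its gradient is a regular
  subgradient. Along tangent sequences the Taylor error divided by \<open>t k\<close>
  vanishes.\<close>

lemma adj_in_subdifferential:
  assumes l: "l \<in> C"
  shows "adj (D x0) l \<in> subdifferential \<phi> x0"
proof -
  obtain \<eta> M K where T: "\<eta> > 0" "M \<ge> 0" "K \<ge> 0" "cball x0 \<eta> \<subseteq> U"
    "\<And>x. x \<in> cball x0 \<eta> \<Longrightarrow> norm (D x) \<le> K"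
    "\<And>x y. x \<in> cball x0 \<eta> \<Longrightarrow> y \<in> cball x0 \<eta> \<Longrightarrow> norm (\<Phi> y - \<Phi> x) \<le> K * norm (y - x)"
    "\<And>x y. x \<in> cball x0 \<eta> \<Longrightarrow> y \<in> cball x0 \<eta> \<Longrightarrow>
      norm (\<Phi> y - \<Phi> x - D x (y - x)) \<le> M * (norm (y - x))\<^sup>2"
    using taylor_bound by metis
  have "(adj (D x0) l, -1) \<in> regular_normal_cone (epi \<phi>) (x0, \<gamma>)"
    unfolding regular_normal_cone_def polar_cone_def tangent_cone_def
  proof clarsimp
    fix w1 w2 t u
    assume t: "\<forall>k. 0 < t k" "t \<longlonglongrightarrow> 0" and u: "u \<longlonglongrightarrow> (w1, w2)"
      and G: "\<forall>k. (x0, \<gamma>) + t k *\<^sub>R u k \<in> epi \<phi>"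
    have f: "(\<lambda>k. fst (u k)) \<longlonglongrightarrow> w1" and g: "(\<lambda>k. snd (u k)) \<longlonglongrightarrow> w2"
      using tendsto_fst[OF u] tendsto_snd[OF u] by simp_all
    have "\<forall>\<^sub>F k in sequentially. norm (t k *\<^sub>R fst (u k)) < \<eta>"
      using tendsto_norm[OF tendsto_scaleR[OF t(2) f]] T(1)
      by (intro order_tendstoD(2)[of _ 0]) auto
    then have ev: "\<forall>\<^sub>F k in sequentially.
        l \<bullet> D x0 (fst (u k)) - norm l * (M * (t k * (norm (fst (u k)))\<^sup>2)) \<le> snd (u k)"
    proof eventually_elim
      case (elim k)
      define a where "a = fst (u k)"
      define y where "y = x0 + t k *\<^sub>R a"
      have tk: "t k > 0" using t by simp
      have y: "y \<in> cball x0 \<eta>" using elim by (simp add: y_def a_def dist_norm)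
      have "\<phi> y \<le> ereal (\<gamma> + t k * snd (u k))"
        using G[rule_format, of k] by (simp add: epi_def y_def a_def plus_prod_def case_prod_beta)
      then have 1: "l \<bullet> (\<Phi> y - \<Phi> x0) \<le> t k * snd (u k)"
        using model y T(4) l by blast
      define e where "e = \<Phi> y - \<Phi> x0 - D x0 (y - x0)"
      have "- (l \<bullet> e) \<le> norm l * norm e"
        using Cauchy_Schwarz_ineq2[of l e] by (simp add: abs_le_iff)
      also have "\<dots> \<le> norm l * (M * (norm (y - x0))\<^sup>2)"
        unfolding e_def using T(1) y by (intro mult_left_mono T(7)) auto
      also have "\<dots> = t k * (norm l * (M * (t k * (norm a)\<^sup>2)))"
        using tk by (simp add: y_def power_mult_distrib power2_eq_square)
      finally have 2: "- (l \<bullet> e) \<le> t k * (norm l * (M * (t k * (norm a)\<^sup>2)))" .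
      have 3: "l \<bullet> (\<Phi> y - \<Phi> x0) = t k * (l \<bullet> D x0 a) + l \<bullet> e"
        by (simp add: e_def y_def blinfun.scaleR_right inner_diff_right)
      have "t k * (l \<bullet> D x0 a - norm l * (M * (t k * (norm a)\<^sup>2))) \<le> t k * snd (u k)"
        using 1 2 3 by (simp only: right_diff_distrib)
      then show ?case using tk by (simp add: a_def)
    qed
    have "(\<lambda>k. l \<bullet> D x0 (fst (u k)) - norm l * (M * (t k * (norm (fst (u k)))\<^sup>2)))
        \<longlonglongrightarrow> l \<bullet> D x0 w1 - norm l * (M * (0 * (norm w1)\<^sup>2))"
      by (intro tendsto_intros blinfun.tendsto f t)
    from tendsto_le[OF _ g this ev] show "adj (D x0) l \<bullet> w1 \<le> w2"
      by (simp add: inner_adj)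
  qed
  then show ?thesis
    using regular_normal_cone_subset[OF x0_in_epi] by (auto simp: subdifferential_def phi_x0)
qed

text \<open>The hypothesis on \<open>\<tau>\<close> makes \<open>(u, \<tau>)\<close> tangent to the
  epigraph, as the velocity of a lifted straightening curve. The exact linearity along
  \<open>S\<close> is essential: the bounds for all \<open>m\<close> in a possibly unbounded
  \<open>C\<close> then hold simultaneously, without a remainder depending on
  \<open>m\<close>.\<close>

lemma regular_normal_chain:
  "\<forall>\<^sub>F x in nhds x0. \<forall>\<alpha> v \<sigma> u \<tau>. (x, \<alpha>) \<in> epi \<phi> \<longrightarrow> (v, \<sigma>) \<in> regular_normal_cone (epi \<phi>) (x, \<alpha>) \<longrightarrow>
    (\<forall>m\<in>C. m \<bullet> D x u \<le> \<tau>) \<longrightarrow> v \<bullet> u + \<sigma> * \<tau> \<le> 0"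
  using straightening_curve
proof eventually_elim
  case (elim x)
  show ?case
  proof (intro allI impI)
    fix \<alpha> v \<sigma> u \<tau>
    assume epi: "(x, \<alpha>) \<in> epi \<phi>" and n: "(v, \<sigma>) \<in> regular_normal_cone (epi \<phi>) (x, \<alpha>)"
      and \<tau>: "\<forall>m\<in>C. m \<bullet> D x u \<le> \<tau>"
    obtain c where c: "c 0 = x" "(c has_vector_derivative u) (at 0)"
      "\<forall>\<^sub>F t in nhds 0. c t \<in> U \<and> P (\<Phi> (c t) - \<Phi> x) = t *\<^sub>R P (D x u)"
      using elim by blast
    have xU: "x \<in> U" using elim by blast
    \<comment> \<open>Each \<open>m\<close> splits into \<open>l0\<close> and \<open>m - l0\<close>
      in \<open>S\<close>. The first two terms absorb the nonlinear contribution of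
      \<open>l0\<close> common to all \<open>m\<close>; their derivatives cancel at 0, so the lift
      has speed \<open>\<tau>\<close>.\<close>
    define \<beta> where "\<beta> t = l0 \<bullet> (\<Phi> (c t) - \<Phi> x) - t * (l0 \<bullet> D x u) + t * \<tau>" for t
    have "((\<lambda>t. \<Phi> (c t)) has_derivative (\<lambda>t. D x (t *\<^sub>R u))) (at 0)"
      using has_derivative_compose[OF c(2)[unfolded has_vector_derivative_def], of \<Phi>] D[OF xU]
      by (simp add: c(1))
    then have "((\<lambda>t. \<Phi> (c t)) has_vector_derivative D x u) (at 0)"
      by (simp add: has_vector_derivative_def blinfun.scaleR_right)
    then have d\<beta>: "(\<beta> has_vector_derivative \<tau>) (at 0)"
      unfolding \<beta>_def[abs_def] has_vector_derivative_def
      by (auto intro!: derivative_eq_intros simp: algebra_simps)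
    have "((\<lambda>t. (c t, \<alpha> + \<beta> t)) has_vector_derivative (u, \<tau>)) (at 0)"
      by (intro has_vector_derivative_Pair c(2)) (auto intro!: derivative_eq_intros d\<beta>)
    moreover have "\<forall>\<^sub>F t in at_right 0. c t \<in> U \<and> P (\<Phi> (c t) - \<Phi> x) = t *\<^sub>R P (D x u)"
      using c(3) by (simp add: eventually_nhds_conv_at eventually_at_split)
    then have "\<forall>\<^sub>F t in at_right 0. (c t, \<alpha> + \<beta> t) \<in> epi \<phi>"
      using eventually_at_right_less[of "0::real"]
    proof eventually_elim
      case (elim t)
      have "m \<bullet> (\<Phi> (c t) - \<Phi> x0) \<le> \<alpha> - \<gamma> + \<beta> t" if m: "m \<in> C" for m
      proof -
        have mS: "m - l0 \<in> S" using diff_in_S[OF m C(3)] .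
        have "(m - l0) \<bullet> (\<Phi> (c t) - \<Phi> x) = t * ((m - l0) \<bullet> D x u)"
          using P(3)[OF mS, of "\<Phi> (c t) - \<Phi> x"] P(3)[OF mS, of "D x u"] elim by simp
        moreover have "t * (m \<bullet> D x u) \<le> t * \<tau>"
          using \<tau> m elim by (intro mult_left_mono) auto
        moreover have "m \<bullet> (\<Phi> x - \<Phi> x0) \<le> \<alpha> - \<gamma>"
          using model[OF xU, of "\<alpha> - \<gamma>"] epi m by (simp add: epi_def)
        ultimately show ?thesis
          by (simp add: \<beta>_def inner_diff_left inner_diff_right right_diff_distrib)
      qed
      then show ?case using model[of "c t" "\<alpha> - \<gamma> + \<beta> t"] elim by (auto simp: epi_def)
    qed
    ultimately have "(u, \<tau>) \<in> tangent_cone (epi \<phi>) (c 0, \<alpha> + \<beta> 0)"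
      by (rule tangent_cone_curve)
    then have "(u, \<tau>) \<in> tangent_cone (epi \<phi>) (x, \<alpha>)"
      by (simp add: \<beta>_def c(1))
    with n show "v \<bullet> u + \<sigma> * \<tau> \<le> 0"
      by (fastforce simp: regular_normal_cone_def polar_cone_def)
  qed
qed

text \<open>A hyperplane with normal \<open>a\<close> and level \<open>b\<close> separating the
  normalized vector from the closed convex set would contradict \<open>regular_normal_chain\<close>
  for \<open>u = - a\<close> and \<open>\<tau> = - b\<close>.\<close>

lemma regular_normal_in_closure:
  "\<forall>\<^sub>F x in nhds x0. \<forall>\<alpha> v \<sigma>. (x, \<alpha>) \<in> epi \<phi> \<longrightarrow> (v, \<sigma>) \<in> regular_normal_cone (epi \<phi>) (x, \<alpha>) \<longrightarrow>
    \<sigma> < 0 \<longrightarrow> (1 / - \<sigma>) *\<^sub>R v \<in> closure (adj (D x) ` C)"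
  using regular_normal_chain
proof eventually_elim
  case (elim x)
  show ?case
  proof (intro allI impI)
    fix \<alpha> v \<sigma>
    assume n: "(x, \<alpha>) \<in> epi \<phi>" "(v, \<sigma>) \<in> regular_normal_cone (epi \<phi>) (x, \<alpha>)" "\<sigma> < 0"
    show "(1 / - \<sigma>) *\<^sub>R v \<in> closure (adj (D x) ` C)"
    proof (rule ccontr)
      assume nin: "(1 / - \<sigma>) *\<^sub>R v \<notin> closure (adj (D x) ` C)"
      have "convex (closure (adj (D x) ` C))"
        by (intro convex_closure convex_linear_image C(2) bounded_linear.linear adj.bounded_linear_right)
      from separating_hyperplane_closed_point[OF this closed_closure nin]
      obtain a b where ab: "a \<bullet> ((1 / - \<sigma>) *\<^sub>R v) < b" "\<And>y. y \<in> closure (adj (D x) ` C) \<Longrightarrow> b < a \<bullet> y"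
        by blast
      have "m \<bullet> D x (- a) \<le> - b" if "m \<in> C" for m
        using ab(2)[of "adj (D x) m"] that closure_subset[of "adj (D x) ` C"]
        by (auto simp: inner_commute[of a] inner_adj blinfun.minus_right)
      then have "v \<bullet> (- a) + \<sigma> * (- b) \<le> 0"
        using elim n by blast
      moreover have "a \<bullet> v < b * (- \<sigma>)"
        using ab(1) n(3) by (simp add: field_simps)
      ultimately show False by (simp add: inner_commute algebra_simps)
    qed
  qed
qed

text \<open>The new content is the upper inclusion. Limiting normals are approximated by
  \<open>adj (D (x k)) (l k)\<close>, and injectivity on \<open>S\<close> prevents the multipliers
  from escaping to infinity, so a compact piece of \<open>C\<close> suffices in the limit.\<close>

lemma subdifferential_eq: "subdifferential \<phi> x0 = adj (D x0) ` C"
proof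
  show "adj (D x0) ` C \<subseteq> subdifferential \<phi> x0"
    using adj_in_subdifferential by blast
  show "subdifferential \<phi> x0 \<subseteq> adj (D x0) ` C"
  proof
    fix v assume "v \<in> subdifferential \<phi> x0"
    then obtain y u where yu: "\<And>k. y k \<in> epi \<phi>" "\<And>k. u k \<in> regular_normal_cone (epi \<phi>) (y k)"
      "y \<longlonglongrightarrow> (x0, \<gamma>)" "u \<longlonglongrightarrow> (v, -1)"
      unfolding subdifferential_def normal_cone_def phi_x0 by auto
    define x where "x k = fst (y k)" for k
    define \<sigma> where "\<sigma> k = snd (u k)" for k
    \<comment> \<open>Normals converging to \<open>(v, -1)\<close> are rescaled to have last
      component exactly -1.\<close>
    define a where "a k = (1 / - \<sigma> k) *\<^sub>R fst (u k)" for k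
    have x: "x \<longlonglongrightarrow> x0" unfolding x_def using tendsto_fst[OF yu(3)] by simp
    have \<sigma>: "\<sigma> \<longlonglongrightarrow> -1" unfolding \<sigma>_def using tendsto_snd[OF yu(4)] by simp
    have "a \<longlonglongrightarrow> (1 / - (-1)) *\<^sub>R v"
      unfolding a_def using tendsto_fst[OF yu(4)] by (intro tendsto_intros \<sigma>) auto
    then have a: "a \<longlonglongrightarrow> v" by simp
    have "\<forall>\<^sub>F k in sequentially. \<sigma> k < 0"
      using order_tendstoD(2)[OF \<sigma>, of 0] by simp
    moreover have "\<forall>\<^sub>F k in sequentially. \<forall>\<alpha> v \<sigma>. (x k, \<alpha>) \<in> epi \<phi> \<longrightarrow>
      (v, \<sigma>) \<in> regular_normal_cone (epi \<phi>) (x k, \<alpha>) \<longrightarrow>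
      \<sigma> < 0 \<longrightarrow> (1 / - \<sigma>) *\<^sub>R v \<in> closure (adj (D (x k)) ` C)"
      using regular_normal_in_closure x unfolding filterlim_def le_filter_def eventually_filtermap by blast
    ultimately have ev: "\<forall>\<^sub>F k in sequentially. a k \<in> closure (adj (D (x k)) ` C)"
    proof eventually_elim
      case (elim k)
      show ?case
        unfolding a_def using elim(2)[rule_format, of "snd (y k)" "fst (u k)" "\<sigma> k"] yu(1,2)[of k] elim(1)
        by (simp add: x_def \<sigma>_def)
    qed
    have "\<exists>l. l \<in> C \<and> dist (adj (D (x k)) l) (a k) < inverse (Suc k)"
      if "a k \<in> closure (adj (D (x k)) ` C)" for k
    proof -
      have "inverse (real (Suc k)) > 0" by simp
      then show ?thesis using that unfolding closure_approachable by blast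
    qed
    then obtain l where l: "\<And>k. a k \<in> closure (adj (D (x k)) ` C) \<Longrightarrow>
        l k \<in> C \<and> dist (adj (D (x k)) (l k)) (a k) < inverse (Suc k)"
      by metis
    have lC: "\<forall>\<^sub>F k in sequentially. l k \<in> C"
      using ev by eventually_elim (use l in blast)
    have Al: "(\<lambda>k. adj (D (x k)) (l k)) \<longlonglongrightarrow> v"
    proof (rule Lim_transform[OF a])
      show "(\<lambda>k. adj (D (x k)) (l k) - a k) \<longlonglongrightarrow> 0"
      proof (rule Lim_null_comparison[OF _ LIMSEQ_inverse_real_of_nat])
        show "\<forall>\<^sub>F k in sequentially. norm (adj (D (x k)) (l k) - a k) \<le> inverse (Suc k)"
          using ev by eventually_elim (use l in \<open>force simp: dist_norm\<close>)
      qed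
    qed
    have Dx: "(\<lambda>k. D (x k)) \<longlonglongrightarrow> D x0"
      using isCont_tendsto_compose[OF isCont_D[OF U(2)] x] .
    \<comment> \<open>A lower bound at \<open>x0\<close> that persists with \<open>e / 2\<close> at
      nearby points; it bounds the multipliers \<open>l k\<close>.\<close>
    obtain e where e: "e > 0" "\<And>s. s \<in> S \<Longrightarrow> e * norm s \<le> norm (adj (D x0) s)"
    proof -
      have "subspace S" unfolding S_def by (rule subspace_span)
      then have "\<exists>e>0. \<forall>s\<in>S. e * norm s \<le> norm (adj (D x0) s)"
        by (intro injective_imp_isometric closed_subspace adj.bounded_linear_right) (use inj in auto)
      then show ?thesis using that by blast
    qed
    have "(\<lambda>k. adj (D (x k)) (l k) - adj (D (x k)) l0) \<longlonglongrightarrow> v - adj (D x0) l0"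
      by (intro tendsto_intros Al adj.tendsto Dx)
    from convergent_imp_Bseq[OF convergentI[OF this]]
    obtain B where B: "\<And>k. norm (adj (D (x k)) (l k) - adj (D (x k)) l0) \<le> B"
      unfolding Bseq_def by blast
    have "\<forall>\<^sub>F k in sequentially. norm (D (x k) - D x0) < e / 2"
      using tendsto_norm_zero[OF LIM_zero[OF Dx]] e(1) by (intro order_tendstoD(2)[of _ 0]) auto
    then have bdd: "\<forall>\<^sub>F k in sequentially. l k \<in> C \<and> norm (l k - l0) \<le> 2 * B / e"
      using lC
    proof eventually_elim
      case (elim k)
      define s where "s = l k - l0"
      have "s \<in> S" unfolding s_def using diff_in_S elim C(3) by blast
      then have "e * norm s \<le> norm (adj (D x0) s)" by (rule e)
      also have "adj (D x0) s = adj (D (x k)) s - adj (D (x k) - D x0) s"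
        by (simp add: adj.diff_left)
      also have "norm \<dots> \<le> norm (adj (D (x k)) s) + norm (adj (D (x k) - D x0) s)"
        by (rule norm_triangle_ineq4)
      also have "norm (adj (D (x k)) s) \<le> B"
        using B[of k] by (simp add: s_def adj.diff_right)
      also have "norm (adj (D (x k) - D x0) s) \<le> e / 2 * norm s"
        using norm_adj[of "D (x k) - D x0" s] elim(1) by (meson less_imp_le mult_right_mono norm_ge_zero order_trans)
      finally have "norm s \<le> 2 * B / e" using e(1) by (simp add: field_simps)
      then show ?case using elim by (simp add: s_def)
    qed
    define R where "R = 2 * B / e"
    \<comment> \<open>Since the multipliers are bounded, the operator may be frozen at
      \<open>x0\<close> without changing the limit.\<close>
    have "(\<lambda>k. adj (D (x k) - D x0) (l k)) \<longlonglongrightarrow> 0"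
    proof (rule Lim_null_comparison)
      show "\<forall>\<^sub>F k in sequentially. norm (adj (D (x k) - D x0) (l k)) \<le> norm (D (x k) - D x0) * (norm l0 + R)"
        using bdd
      proof eventually_elim
        case (elim k)
        have "norm (l k) \<le> norm l0 + R"
          using elim norm_triangle_sub[of "l k" l0] by (simp add: R_def)
        then show ?case
          using norm_adj[of "D (x k) - D x0" "l k"] by (meson mult_left_mono norm_ge_zero order_trans)
      qed
      show "(\<lambda>k. norm (D (x k) - D x0) * (norm l0 + R)) \<longlonglongrightarrow> 0"
        using tendsto_mult_right[OF tendsto_norm_zero[OF LIM_zero[OF Dx]]] by simp
    qed
    from tendsto_diff[OF Al this] have lim: "(\<lambda>k. adj (D x0) (l k)) \<longlonglongrightarrow> v"
      by (simp add: adj.diff_left)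
    let ?K = "C \<inter> cball l0 R"
    have "compact ?K" using C(1) by (simp add: closed_Int_compact)
    then have "closed (adj (D x0) ` ?K)"
      by (intro compact_imp_closed compact_continuous_image linear_continuous_on adj.bounded_linear_right)
    moreover have "\<forall>\<^sub>F k in sequentially. adj (D x0) (l k) \<in> adj (D x0) ` ?K"
      using bdd by eventually_elim (auto simp: R_def dist_norm norm_minus_commute)
    ultimately have "v \<in> adj (D x0) ` ?K"
      using lim by (intro Lim_in_closed_set[of "adj (D x0) ` ?K"]) auto
    then show "v \<in> adj (D x0) ` C" by blast
  qed
qed

text \<open>Linear maps commute with relative interiors of convex sets, and injectivity on
  differences of points of \<open>C\<close> makes \<open>l0\<close> the only multiplier.\<close>

lemma rel_interior_subdifferential_iff:
  "adj (D x0) l0 \<in> rel_interior (subdifferential \<phi> x0) \<longleftrightarrow> l0 \<in> rel_interior C"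
proof -
  have ri: "rel_interior (subdifferential \<phi> x0) = adj (D x0) ` rel_interior C"
    unfolding subdifferential_eq
    by (rule rel_interior_convex_linear_image[symmetric])
      (auto intro: bounded_linear.linear adj.bounded_linear_right C)
  have "l = l0" if "l \<in> C" "adj (D x0) l0 = adj (D x0) l" for l
    using inj[OF diff_in_S[OF that(1) C(3)]] that(2) by (simp add: adj.diff_right)
  then have "l0 \<in> rel_interior C" if "adj (D x0) l0 \<in> adj (D x0) ` rel_interior C"
    using that rel_interior_subset[of C] by (metis imageE subsetD)
  then show ?thesis
    unfolding ri by auto
qed

section \<open>From the relative interior to smooth proximal mappings\<close>

text \<open>Upgrades first-order conditions to global minimality: the neighbourhood and the bound on
  \<open>r\<close> are uniform over the admissible pairs \<open>(w, l)\<close>.\<close>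

lemma prox_kkt:
  obtains \<rho> \<eta> where "\<rho> > 0" "\<eta> > 0" "ball x0 \<eta> \<subseteq> U"
    "\<And>w l r. \<lbrakk>w \<in> ball x0 \<eta>; l \<in> C; norm (l - l0) \<le> 1;
        \<And>m. m \<in> C \<Longrightarrow> (m - l) \<bullet> (\<Phi> w - \<Phi> x0) \<le> 0; 0 < r; r * \<rho> < 1\<rbrakk> \<Longrightarrow>
      prox r \<phi> (w + r *\<^sub>R adj (D w) l) = {w}"
proof -
  obtain \<rho> \<eta> where *: "\<rho> > 0" "\<eta> > 0" "ball x0 \<eta> \<subseteq> U"
    "\<And>w l y. \<lbrakk>w \<in> ball x0 \<eta>; l \<in> C; norm (l - l0) \<le> 1;
        \<And>m. m \<in> C \<Longrightarrow> (m - l) \<bullet> (\<Phi> w - \<Phi> x0) \<le> 0\<rbrakk> \<Longrightarrow>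
      ereal (\<gamma> + l \<bullet> (\<Phi> w - \<Phi> x0) + adj (D w) l \<bullet> (y - w) - \<rho> / 2 * (norm (y - w))\<^sup>2) \<le> \<phi> y"
    using uniform_minorant by metis
  have "prox r \<phi> (w + r *\<^sub>R adj (D w) l) = {w}"
    if "w \<in> ball x0 \<eta>" "l \<in> C" "norm (l - l0) \<le> 1"
      "\<And>m. m \<in> C \<Longrightarrow> (m - l) \<bullet> (\<Phi> w - \<Phi> x0) \<le> 0" "0 < r" "r * \<rho> < 1" for w l r
  proof (rule prox_eq_singleton)
    show "\<phi> w = ereal (\<gamma> + l \<bullet> (\<Phi> w - \<Phi> x0))"
      using that *(3) by (intro phi_eq) auto
  qed (use that *(4)[OF that(1-4)] in auto)
  then show ?thesis using that * by blast
qed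

text \<open>When \<open>l0\<close> is relatively interior, small perturbations within
  \<open>S\<close> stay in \<open>C\<close>, so every local solution of the smooth system with
  second component 0 satisfies the variational inequality over \<open>C\<close>. Its first component
  is then the proximal point.\<close>

lemma prox_C1:
  assumes ri: "l0 \<in> rel_interior C"
  shows "\<exists>\<rho>>0. \<forall>r\<in>{0<..<1 / \<rho>}. set_valued_C1_around (prox r \<phi>) (x0 + r *\<^sub>R adj (D x0) l0)"
proof -
  obtain \<rho> \<eta> where prox: "\<rho> > 0" "\<eta> > 0" "ball x0 \<eta> \<subseteq> U"
    "\<And>w l r. \<lbrakk>w \<in> ball x0 \<eta>; l \<in> C; norm (l - l0) \<le> 1;
        \<And>m. m \<in> C \<Longrightarrow> (m - l) \<bullet> (\<Phi> w - \<Phi> x0) \<le> 0; 0 < r; r * \<rho> < 1\<rbrakk> \<Longrightarrow>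
      prox r \<phi> (w + r *\<^sub>R adj (D w) l) = {w}"
    using prox_kkt by metis
  obtain \<epsilon> where \<epsilon>: "\<epsilon> > 0" "\<And>s. s \<in> S \<Longrightarrow> norm s < \<epsilon> \<Longrightarrow> l0 + s \<in> C"
    using rel_interior_span_ball[OF C(3) ri] S_def by metis
  \<comment> \<open>With the bound \<open>1 / (\<rho> + k)\<close>, both smallness conditions hold:
    \<open>r * \<rho> < 1\<close> for global minimality and \<open>r * k < 1\<close> for
    invertibility.\<close>
  define k where "k = norm l0 * norm (D2 x0)"
  have k: "k \<ge> 0" by (simp add: k_def)
  have "set_valued_C1_around (prox r \<phi>) (x0 + r *\<^sub>R adj (D x0) l0)"
    if "r \<in> {0<..<1 / (\<rho> + k)}" for r
  proof -
    have "r * (\<rho> + k) < 1" and r0: "r > 0"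
      using that prox(1) k by (auto simp: field_simps)
    moreover have "0 \<le> r * \<rho>" "0 \<le> r * k" using r0 prox(1) k by simp_all
    ultimately have r: "r * \<rho> < 1" "r * (norm l0 * norm (D2 x0)) < 1"
      unfolding k_def[symmetric] by (simp_all add: distrib_left)
    obtain W V G where W: "open W" "W \<subseteq> U \<times> UNIV" "(x0, 0) \<in> W" "open V"
      "homeomorphism W V (kkt r) G" "C1_on V G"
      using kkt_local_inverse[OF r0 r(2)] by metis
    have GV: "kkt r q \<in> V" "G (kkt r q) = q" if "q \<in> W" for q
      using W(5) that by (auto simp: homeomorphism_def)
    have G: "G y \<in> W" "kkt r (G y) = y" if "y \<in> V" for y
      using W(5) that by (auto simp: homeomorphism_def)
    define y0 where "y0 = x0 + r *\<^sub>R adj (D x0) l0"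
    have k0: "kkt r (x0, 0) = (y0, 0)" by (simp add: kkt_def y0_def P.zero)
    have yV: "(y0, 0) \<in> V" and Gy: "G (y0, 0) = (x0, 0)"
      using GV[OF W(3)] unfolding k0 by auto
    define p where "p y = fst (G (y, 0))" for y
    have pair: "((\<lambda>y. (y, 0 :: 'b)) \<longlongrightarrow> (y0, 0)) (nhds y0)"
      by (intro tendsto_intros filterlim_ident)
    have "continuous_on V G" using W(5) by (simp add: homeomorphism_def)
    then have "(G \<longlongrightarrow> G (y0, 0)) (nhds (y0, 0))"
      using W(4) yV continuous_on_eq_continuous_at isCont_def tendsto_at_iff_tendsto_nhds by metis
    then have lim: "((\<lambda>y. G (y, 0)) \<longlongrightarrow> (x0, 0)) (nhds y0)"
      unfolding Gy by (rule filterlim_compose[OF _ pair])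
    have 1: "\<forall>\<^sub>F y in nhds y0. (y, 0) \<in> V"
      using topological_tendstoD[OF pair W(4) yV] .
    have 2: "\<forall>\<^sub>F y in nhds y0. G (y, 0) \<in> ball x0 \<eta> \<times> ball 0 (min \<epsilon> 1)"
      using prox(2) \<epsilon>(1) by (intro topological_tendstoD[OF lim] open_Times open_ball) auto
    from 1 2 have "\<forall>\<^sub>F y in nhds y0. prox r \<phi> y = {p y}"
    proof eventually_elim
      case (elim y)
      define w where "w = fst (G (y, 0))"
      define m where "m = snd (G (y, 0))"
      have wm: "w \<in> ball x0 \<eta>" "norm m < \<epsilon>" "norm m \<le> 1"
        using elim(2) by (auto simp: w_def m_def mem_Times_iff)
      have e1: "w + r *\<^sub>R adj (D w) (l0 + P m) = y" and e2: "P (\<Phi> w - \<Phi> x0) + (m - P m) = 0"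
        using G(2)[OF elim(1)] by (auto simp: kkt_def w_def m_def)
      have "P (P (\<Phi> w - \<Phi> x0) + (m - P m)) = P (\<Phi> w - \<Phi> x0)"
        by (simp add: P.add P.diff)
      then have P0: "P (\<Phi> w - \<Phi> x0) = 0" using e2 by (simp add: P.zero)
      then have Pm: "P m = m" using e2 by simp
      then have mS: "m \<in> S" using P(2)[of m] by simp
      have lC: "l0 + m \<in> C" using \<epsilon>(2)[OF mS wm(2)] .
      \<comment> \<open>Differences of points of \<open>C\<close> lie in \<open>S\<close>, where the
        projected value vanishes, so the pairing is in fact zero.\<close>
      have "(n - (l0 + m)) \<bullet> (\<Phi> w - \<Phi> x0) \<le> 0" if "n \<in> C" for n
        using P(3)[OF diff_in_S[OF that lC], of "\<Phi> w - \<Phi> x0"] P0 by simp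
      then have "prox r \<phi> (w + r *\<^sub>R adj (D w) (l0 + m)) = {w}"
        using wm lC r0 r by (intro prox(4)) auto
      then show ?case using e1 Pm by (simp add: p_def w_def)
    qed
    moreover have "C1_around p y0"
      unfolding C1_around_def
    proof (intro exI conjI)
      show "C1_on {y. (y, 0) + 0 \<in> V} p"
        unfolding p_def[abs_def]
        using C1_on_bounded_linear_comp[OF W(6) bounded_linear_fst, of "\<lambda>y. (y, 0)" 0]
        by (simp add: bounded_linear_Pair bounded_linear_ident bounded_linear_zero)
      show "y0 \<in> {y. (y, 0) + 0 \<in> V}" using yV by simp
      have "open ((\<lambda>y. (y, 0 :: 'b)) -` V)"
        by (intro open_vimage W(4) continuous_intros)
      then show "open {y. (y, 0) + 0 \<in> V}" by (simp add: vimage_def)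
    qed
    ultimately show ?thesis
      unfolding set_valued_C1_around_def y0_def by blast
  qed
  then show ?thesis
    using prox(1) k by (intro exI[of _ "\<rho> + k"]) auto
qed

text \<open>Write \<open>p = id - r \<nabla>e\<close> and \<open>L = p'(x0 + r v)\<close>. If \<open>l0\<close> is not in the relative interior, the
  proximal points give \<open>L (adj (D x0) (m - l0)) = 0\<close> for \<open>m\<close> in \<open>C\<close>, and \<open>L h = u\<close> for some \<open>u\<close>
  transversal to the fibre of \<open>P \<circ> \<Phi>\<close>. Positivity of \<open>L\<close> makes its range orthogonal to its kernel,
  which contradicts the choice of \<open>u\<close>.\<close>

lemma moreau_C2_imp_rel_interior:
  assumes C2: "\<exists>\<rho>>0. \<forall>r\<in>{0<..<1 / \<rho>}. ereal_C2_around (moreau_envelope r \<phi>) (x0 + r *\<^sub>R adj (D x0) l0)"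
  shows "l0 \<in> rel_interior C"
proof (rule ccontr)
  assume "l0 \<notin> rel_interior C"
  moreover have "l0 \<in> closure C" using C(3) closure_subset by blast
  ultimately obtain a where a: "\<And>m. m \<in> closure C \<Longrightarrow> a \<bullet> l0 \<le> a \<bullet> m"
    "\<And>m. m \<in> rel_interior C \<Longrightarrow> a \<bullet> l0 < a \<bullet> m"
    using supporting_hyperplane_relative_frontier[OF C(2)] by metis
  \<comment> \<open>With the sign reversed, \<open>l0\<close> maximizes the pairing with
    \<open>d\<close> over \<open>C\<close>; properness of the support provides \<open>m1\<close>
    with a strictly smaller value.\<close>
  define d where "d = - a"
  have d: "(m - l0) \<bullet> d \<le> 0" if "m \<in> C" for m
    using a(1)[of m] that closure_subset[of C]
    by (auto simp: d_def inner_commute[of _ a] inner_diff_right)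
  obtain m1 where m1: "m1 \<in> C" "(m1 - l0) \<bullet> d < 0"
  proof -
    obtain m where "m \<in> rel_interior C"
      using rel_interior_eq_empty[OF C(2)] C(3) by blast
    then show ?thesis
      using that[of m] a(2)[of m] rel_interior_subset[of C]
      by (auto simp: d_def inner_commute[of _ a] inner_diff_right)
  qed
  obtain \<rho>1 \<eta> where prox: "\<rho>1 > 0" "\<eta> > 0" "ball x0 \<eta> \<subseteq> U"
    "\<And>w l r. \<lbrakk>w \<in> ball x0 \<eta>; l \<in> C; norm (l - l0) \<le> 1;
        \<And>m. m \<in> C \<Longrightarrow> (m - l) \<bullet> (\<Phi> w - \<Phi> x0) \<le> 0; 0 < r; r * \<rho>1 < 1\<rbrakk> \<Longrightarrow>
      prox r \<phi> (w + r *\<^sub>R adj (D w) l) = {w}"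
    using prox_kkt by metis
  obtain \<rho>2 where \<rho>2: "\<rho>2 > 0"
    "\<And>r. r \<in> {0<..<1 / \<rho>2} \<Longrightarrow> ereal_C2_around (moreau_envelope r \<phi>) (x0 + r *\<^sub>R adj (D x0) l0)"
    using C2 by blast
  define r where "r = 1 / (\<rho>1 + \<rho>2 + 1)"
  have r: "r > 0" "r * \<rho>1 < 1" "r \<in> {0<..<1 / \<rho>2}"
    using prox(1) \<rho>2(1) by (auto simp: r_def field_simps)
  define y0 where "y0 = x0 + r *\<^sub>R adj (D x0) l0"
  obtain e V E E' where e: "\<forall>\<^sub>F y in nhds y0. moreau_envelope r \<phi> y = ereal (e y)" "open V" "y0 \<in> V"
    and E: "\<And>y. y \<in> V \<Longrightarrow> (e has_derivative blinfun_apply (E y)) (at y)"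
    and E': "\<And>y. y \<in> V \<Longrightarrow> (E has_derivative blinfun_apply (E' y)) (at y)"
    using \<rho>2(2)[OF r(3)] unfolding ereal_C2_around_def C2_around_def C2_on_def C1_on_def y0_def by blast
  \<comment> \<open>Smoothness of the envelope does not by itself name proximal points, so
    \<open>p\<close> is defined by the gradient step; \<open>adj (E y) 1\<close> is the gradient of
    \<open>e\<close>. The fact \<open>p_eq\<close> identifies \<open>p y\<close> with any proximal
    point of finite value.\<close>
  define p where "p y = y - r *\<^sub>R adj (E y) 1" for y
  define L where "L h = h - r *\<^sub>R adj (E' y0 h) 1" for h
  have pL: "(p has_derivative L) (at y0)"
    unfolding p_def[abs_def] L_def[abs_def]
    by (intro has_derivative_diff has_derivative_ident has_derivative_scaleR_right
      bounded_linear.has_derivative[OF adj.bounded_linear_left] E' e(3))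
  then have linL: "linear L" by (rule has_derivative_linear)
  have p_eq: "\<forall>\<^sub>F y in nhds y0. \<forall>w. \<bar>\<phi> w\<bar> \<noteq> \<infinity> \<longrightarrow> w \<in> prox r \<phi> y \<longrightarrow> p y = w"
  proof -
    have "\<forall>\<^sub>F y in nhds y0. \<forall>\<^sub>F z in nhds y. moreau_envelope r \<phi> z = ereal (e z)"
      using e(1) by (simp add: eventually_eventually)
    moreover have "\<forall>\<^sub>F y in nhds y0. y \<in> V"
      using e(2,3) by (rule eventually_nhds_in_open)
    ultimately show ?thesis
    proof eventually_elim
      case (elim y)
      show ?case
      proof (intro allI impI)
        fix w assume w: "\<bar>\<phi> w\<bar> \<noteq> \<infinity>" "w \<in> prox r \<phi> y"
        then have "\<phi> w = ereal (real_of_ereal (\<phi> w))" by (simp add: ereal_real)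
        from moreau_envelope_derivative[OF elim(1) w(2) this r(1) E[OF elim(2)]]
        have "adj (E y) 1 \<bullet> h = ((1 / r) *\<^sub>R (y - w)) \<bullet> h" for h
          by (simp add: inner_adj)
        then have "adj (E y) 1 = (1 / r) *\<^sub>R (y - w)"
          using vector_eq_rdot by blast
        then show "p y = w" using r(1) by (simp add: p_def)
      qed
    qed
  qed
  have prox_p: "\<forall>\<^sub>F y in nhds y0. \<forall>w l. w \<in> ball x0 \<eta> \<longrightarrow> l \<in> C \<longrightarrow> norm (l - l0) \<le> 1 \<longrightarrow>
      (\<forall>m\<in>C. (m - l) \<bullet> (\<Phi> w - \<Phi> x0) \<le> 0) \<longrightarrow> y = w + r *\<^sub>R adj (D w) l \<longrightarrow> p y = w"
    using p_eq
  proof eventually_elim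
    case (elim y)
    show ?case
    proof (intro allI impI)
      fix w l assume *: "w \<in> ball x0 \<eta>" "l \<in> C" "norm (l - l0) \<le> 1"
        "\<forall>m\<in>C. (m - l) \<bullet> (\<Phi> w - \<Phi> x0) \<le> 0" "y = w + r *\<^sub>R adj (D w) l"
      then have "\<phi> w = ereal (\<gamma> + l \<bullet> (\<Phi> w - \<Phi> x0))"
        using prox(3) by (intro phi_eq) auto
      moreover have "prox r \<phi> y = {w}"
        using * r prox(4) by blast
      ultimately show "p y = w" using elim by auto
    qed
  qed
  have py0: "p y0 = x0"
    using eventually_nhds_x_imp_x[OF prox_p] C(3) prox(2) unfolding y0_def by simp
  \<comment> \<open>\<open>L\<close> is evaluated along curves whose proximal points are known
    explicitly for positive times.\<close>
  have curve: "L h = u"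
    if X: "(X has_vector_derivative h) (at 0)" "X 0 = y0" and c: "(c has_vector_derivative u) (at 0)" "c 0 = x0"
      and ev: "\<forall>\<^sub>F t in at_right 0. p (X t) = c t" for X c h u
  proof (rule vector_derivative_eq_at_right[OF _ c(1)])
    have "((\<lambda>t. p (X t)) has_derivative (\<lambda>t. L (t *\<^sub>R h))) (at 0)"
      using has_derivative_compose[OF X(1)[unfolded has_vector_derivative_def], of p L] pL by (simp add: X(2))
    then show "((\<lambda>t. p (X t)) has_vector_derivative L h) (at 0)"
      by (simp add: has_vector_derivative_def linear_scale[OF linL])
    show "p (X 0) = c 0" by (simp add: X(2) c(2) py0)
  qed (rule ev)
  have lim_curve: "(X \<longlongrightarrow> X 0) (at_right 0)"
    if "(X has_vector_derivative h) (at 0)" for X :: "real \<Rightarrow> 'a" and h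
    using has_vector_derivative_continuous[OF that] unfolding isCont_def
    by (rule tendsto_within_subset) simp
  \<comment> \<open>Moving the multiplier from \<open>l0\<close> towards \<open>m\<close> while
    keeping the point \<open>x0\<close> leaves the proximal point fixed, so the corresponding
    velocity is annihilated by \<open>L\<close>.\<close>
  have ker: "L (adj (D x0) (m - l0)) = 0" if m: "m \<in> C" for m
  proof -
    define X where "X t = x0 + r *\<^sub>R adj (D x0) (l0 + t *\<^sub>R (m - l0))" for t
    have X: "(X has_vector_derivative r *\<^sub>R adj (D x0) (m - l0)) (at 0)"
      unfolding X_def[abs_def] adj.add_right adj.scaleR_right
      by (auto intro!: derivative_eq_intros simp: scaleR_add_right)
    have X0: "X 0 = y0" by (simp add: X_def y0_def)
    have "\<forall>\<^sub>F t in at_right 0. t < 1 / (norm (m - l0) + 1)"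
      by (intro order_tendstoD(2)[OF tendsto_ident_at]) (simp add: add_nonneg_pos)
    moreover have "\<forall>\<^sub>F t in at_right 0. t < (1::real)"
      by (intro order_tendstoD(2)[OF tendsto_ident_at]) simp
    moreover have "\<forall>\<^sub>F t in at_right 0. \<forall>w l. w \<in> ball x0 \<eta> \<longrightarrow> l \<in> C \<longrightarrow> norm (l - l0) \<le> 1 \<longrightarrow>
      (\<forall>m\<in>C. (m - l) \<bullet> (\<Phi> w - \<Phi> x0) \<le> 0) \<longrightarrow> X t = w + r *\<^sub>R adj (D w) l \<longrightarrow> p (X t) = w"
      using eventually_compose_filterlim[OF prox_p] lim_curve[OF X] unfolding X0 by blast
    ultimately have "\<forall>\<^sub>F t in at_right 0. p (X t) = x0"
      using eventually_at_right_less[of "0::real"]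
    proof eventually_elim
      case (elim t)
      have "l0 + t *\<^sub>R (m - l0) = (1 - t) *\<^sub>R l0 + t *\<^sub>R m" by (simp add: algebra_simps)
      then have "l0 + t *\<^sub>R (m - l0) \<in> C"
        using convexD_alt[OF C(2) C(3) m, of t] elim by simp
      moreover have "t * norm (m - l0) \<le> 1"
      proof -
        have "t * (norm (m - l0) + 1) < 1"
          using elim(1) by (simp add: less_divide_eq add_nonneg_pos)
        then show ?thesis using elim by (simp add: distrib_left)
      qed
      ultimately show ?case
        using elim(3)[rule_format, of x0 "l0 + t *\<^sub>R (m - l0)"] elim(4) prox(2) by (simp add: X_def)
    qed
    from curve[OF X X0 _ _ this] have "L (r *\<^sub>R adj (D x0) (m - l0)) = 0" by simp
    then show ?thesis using r(1) by (simp add: linear_scale[OF linL])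
  qed
  have pos: "h \<bullet> L h \<ge> 0" for h
  proof (rule ccontr)
    assume neg: "\<not> h \<bullet> L h \<ge> 0"
    define f where "f t = h \<bullet> (p (y0 + t *\<^sub>R h) - x0)" for t
    \<comment> \<open>\<open>Q\<close> is the gap between the quadratic majorant with competitor
      \<open>x0\<close> and the envelope along the line. It is nonnegative, vanishes at 0 and has
      derivative \<open>f / r\<close>; a negative \<open>h . L h\<close> would make \<open>f\<close>
      negative just after 0 and, by the mean value theorem, \<open>Q\<close> negative.\<close>
    define Q where "Q t = \<gamma> + 1 / (2 * r) * (norm (x0 - (y0 + t *\<^sub>R h)))\<^sup>2 - e (y0 + t *\<^sub>R h)" for t
    have line: "((\<lambda>t. y0 + t *\<^sub>R h) has_derivative (\<lambda>s. s *\<^sub>R h)) (at t)" for t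
      by (auto intro!: derivative_eq_intros)
    have "((\<lambda>t. p (y0 + t *\<^sub>R h)) has_derivative (\<lambda>s. L (s *\<^sub>R h))) (at 0)"
      using has_derivative_compose[OF line[of 0], of p L] pL by simp
    then have "(f has_derivative (\<lambda>s. h \<bullet> L (s *\<^sub>R h))) (at 0)"
      unfolding f_def[abs_def] by (auto intro!: derivative_eq_intros)
    then have "(f has_real_derivative h \<bullet> L h) (at 0)"
      by (simp add: has_field_derivative_def linear_scale[OF linL] mult_commute_abs)
    then obtain \<delta>1 where \<delta>1: "\<delta>1 > 0" "\<And>t. 0 < t \<Longrightarrow> t < \<delta>1 \<Longrightarrow> f t < 0"
      using has_real_derivative_neg_dec_right[of f "h \<bullet> L h" 0 UNIV] neg by (auto simp: f_def py0)
    have "\<forall>\<^sub>F y in nhds y0. y \<in> V \<and> moreau_envelope r \<phi> y = ereal (e y)"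
      using e(1) eventually_nhds_in_open[OF e(2,3)] by eventually_elim auto
    then have "\<forall>\<^sub>F t in nhds 0. y0 + t *\<^sub>R h \<in> V \<and> moreau_envelope r \<phi> (y0 + t *\<^sub>R h) = ereal (e (y0 + t *\<^sub>R h))"
    proof (rule eventually_compose_filterlim)
      have "((\<lambda>t. y0 + t *\<^sub>R h) \<longlongrightarrow> y0 + 0 *\<^sub>R h) (nhds 0)"
        by (intro tendsto_intros filterlim_ident)
      then show "((\<lambda>t. y0 + t *\<^sub>R h) \<longlongrightarrow> y0) (nhds 0)" by simp
    qed
    then obtain \<delta>2 where \<delta>2: "\<delta>2 > 0" "\<And>t. \<bar>t\<bar> < \<delta>2 \<Longrightarrow> y0 + t *\<^sub>R h \<in> V"
      "\<And>t. \<bar>t\<bar> < \<delta>2 \<Longrightarrow> moreau_envelope r \<phi> (y0 + t *\<^sub>R h) = ereal (e (y0 + t *\<^sub>R h))"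
      unfolding eventually_nhds_metric by (auto simp: dist_real_def)
    have Q': "(Q has_real_derivative (1 / r) * f t) (at t)" if "\<bar>t\<bar> < \<delta>2" for t
    proof -
      have "((\<lambda>t. e (y0 + t *\<^sub>R h)) has_derivative (\<lambda>s. E (y0 + t *\<^sub>R h) (s *\<^sub>R h))) (at t)"
        by (rule has_derivative_compose[OF line E[OF \<delta>2(2)[OF that]]])
      then have e': "((\<lambda>t. e (y0 + t *\<^sub>R h)) has_real_derivative adj (E (y0 + t *\<^sub>R h)) 1 \<bullet> h) (at t)"
        by (simp add: has_field_derivative_def inner_adj blinfun.scaleR_right mult_commute_abs)
      have sq: "(norm (x0 - (y0 + t *\<^sub>R h)))\<^sup>2 = (norm (x0 - y0))\<^sup>2 - 2 * t * ((x0 - y0) \<bullet> h) + t\<^sup>2 * (h \<bullet> h)" for t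
        unfolding power2_norm_eq_inner by (simp add: algebra_simps inner_commute power2_eq_square)
      have "(Q has_real_derivative 1 / (2 * r) * (- 2 * ((x0 - y0) \<bullet> h) + 2 * t * (h \<bullet> h)) - adj (E (y0 + t *\<^sub>R h)) 1 \<bullet> h) (at t)"
        unfolding Q_def[abs_def] sq using r(1) by (auto intro!: derivative_eq_intros e' simp: field_simps)
      moreover have "1 / (2 * r) * (- 2 * ((x0 - y0) \<bullet> h) + 2 * t * (h \<bullet> h)) - adj (E (y0 + t *\<^sub>R h)) 1 \<bullet> h = (1 / r) * f t"
        using r(1) by (simp add: f_def p_def inner_diff_left inner_diff_right inner_add_right inner_commute field_simps)
      ultimately show ?thesis by simp
    qed
    have prox0: "prox r \<phi> y0 = {x0}"
      unfolding y0_def using C(3) prox(2) r by (intro prox(4)) auto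
    have Q0: "Q 0 = 0"
    proof -
      have "ereal (e y0) = \<phi> x0 + ereal (1 / (2 * r) * (norm (x0 - y0))\<^sup>2)"
        using \<delta>2(3)[of 0] \<delta>2(1) moreau_envelope_prox[of x0 r \<phi> y0] prox0 by simp
      then show ?thesis by (simp add: Q_def phi_x0)
    qed
    have Qt: "Q t \<ge> 0" if "\<bar>t\<bar> < \<delta>2" for t
    proof -
      have "moreau_envelope r \<phi> (y0 + t *\<^sub>R h) \<le> \<phi> x0 + ereal (1 / (2 * r) * (norm (x0 - (y0 + t *\<^sub>R h)))\<^sup>2)"
        unfolding moreau_envelope_def by (rule INF_lower) auto
      then show ?thesis using \<delta>2(3)[OF that] by (simp add: Q_def phi_x0)
    qed
    define t where "t = min \<delta>1 \<delta>2 / 2"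
    have t: "0 < t" "t < \<delta>1" "t < \<delta>2" using \<delta>1(1) \<delta>2(1) by (auto simp: t_def min_def)
    obtain z where z: "0 < z" "z < t" "Q t - Q 0 = (t - 0) * ((1 / r) * f z)"
      using MVT2[of 0 t Q "\<lambda>z. (1 / r) * f z"] Q' t by (metis abs_of_nonneg order.strict_trans1)
    have "f z < 0" using \<delta>1(2) z t by simp
    then have "t * ((1 / r) * f z) < 0" using t(1) r(1) by (simp add: mult_pos_neg divide_neg_pos)
    then show False using z(3) Q0 Qt[of t] t by simp
  qed
  have orth: "k \<bullet> L h = 0" if "L k = 0" for k h
  proof (rule ccontr)
    assume ne: "k \<bullet> L h \<noteq> 0"
    \<comment> \<open>Adding a kernel vector changes the quadratic form affinely; this multiple
      brings its value to -1.\<close>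
    define \<tau> where "\<tau> = - (h \<bullet> L h + 1) / (k \<bullet> L h)"
    have "(h + \<tau> *\<^sub>R k) \<bullet> L (h + \<tau> *\<^sub>R k) = h \<bullet> L h + \<tau> * (k \<bullet> L h)"
      using that by (simp add: linear_add[OF linL] linear_scale[OF linL] inner_add_left)
    also have "\<dots> = -1" using ne by (simp add: \<tau>_def)
    finally show False using pos[of "h + \<tau> *\<^sub>R k"] by simp
  qed
  obtain u where u: "P (D x0 u) = P d" by (rule derivative_onto)
  obtain c where c: "c 0 = x0" "(c has_vector_derivative u) (at 0)"
      "\<forall>\<^sub>F t in nhds 0. c t \<in> U \<and> P (\<Phi> (c t) - \<Phi> x0) = t *\<^sub>R P (D x0 u)"
    using eventually_nhds_x_imp_x[OF straightening_curve] by blast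
  \<comment> \<open>Along \<open>c\<close> the projected values move by \<open>t * P d\<close>, so
    the fixed multiplier \<open>l0\<close> remains maximizing and \<open>c t\<close> is the proximal
    point of \<open>X t\<close>.\<close>
  define X where "X t = c t + r *\<^sub>R adj (D (c t)) l0" for t
  have X0: "X 0 = y0" by (simp add: X_def y0_def c(1))
  have X: "(X has_vector_derivative u + r *\<^sub>R adj (D2 x0 u) l0) (at 0)"
  proof -
    have "((\<lambda>t. D (c t)) has_derivative (\<lambda>t. D2 x0 (t *\<^sub>R u))) (at 0)"
      using has_derivative_compose[OF c(2)[unfolded has_vector_derivative_def], of D] D2(1)[OF U(2)]
      by (simp add: c(1))
    from bounded_linear.has_derivative[OF adj.bounded_linear_left this, of l0]
    have "((\<lambda>t. adj (D (c t)) l0) has_vector_derivative adj (D2 x0 u) l0) (at 0)"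
      by (simp add: has_vector_derivative_def blinfun.scaleR_right adj.scaleR_left)
    then show ?thesis
      unfolding X_def[abs_def] by (auto intro!: derivative_eq_intros c(2))
  qed
  have "\<forall>\<^sub>F t in at_right 0. c t \<in> U \<and> P (\<Phi> (c t) - \<Phi> x0) = t *\<^sub>R P (D x0 u)"
    using c(3) by (simp add: eventually_nhds_conv_at eventually_at_split)
  moreover have "\<forall>\<^sub>F t in at_right 0. c t \<in> ball x0 \<eta>"
    using topological_tendstoD[OF lim_curve[OF c(2)], of "ball x0 \<eta>"] prox(2) by (simp add: c(1))
  moreover have "\<forall>\<^sub>F t in at_right 0. \<forall>w l. w \<in> ball x0 \<eta> \<longrightarrow> l \<in> C \<longrightarrow> norm (l - l0) \<le> 1 \<longrightarrow>
      (\<forall>m\<in>C. (m - l) \<bullet> (\<Phi> w - \<Phi> x0) \<le> 0) \<longrightarrow> X t = w + r *\<^sub>R adj (D w) l \<longrightarrow> p (X t) = w"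
    using eventually_compose_filterlim[OF prox_p] lim_curve[OF X] unfolding X0 by blast
  ultimately have "\<forall>\<^sub>F t in at_right 0. p (X t) = c t"
    using eventually_at_right_less[of "0::real"]
  proof eventually_elim
    case (elim t)
    have "(m - l0) \<bullet> (\<Phi> (c t) - \<Phi> x0) \<le> 0" if m: "m \<in> C" for m
    proof -
      have mS: "m - l0 \<in> S" using diff_in_S[OF m C(3)] .
      have "(m - l0) \<bullet> (\<Phi> (c t) - \<Phi> x0) = t * ((m - l0) \<bullet> d)"
        using P(3)[OF mS, of "\<Phi> (c t) - \<Phi> x0"] P(3)[OF mS, of d] elim u by simp
      then show ?thesis using d[OF m] elim by (simp add: mult_le_0_iff)
    qed
    then show ?case using elim C(3) by (auto simp: X_def)
  qed
  \<comment> \<open>Thus \<open>u\<close> is in the range of \<open>L\<close>, while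
    \<open>adj (D x0) (m1 - l0)\<close> is in its kernel; their orthogonality reads
    \<open>(m1 - l0) . d = 0\<close>.\<close>
  from curve[OF X X0 c(2,1) this] have "L (u + r *\<^sub>R adj (D2 x0 u) l0) = u" .
  with orth[OF ker[OF m1(1)]] have "adj (D x0) (m1 - l0) \<bullet> u = 0" by metis
  then have "(m1 - l0) \<bullet> D x0 u = 0" by (simp add: inner_adj)
  then have "(m1 - l0) \<bullet> d = 0"
    using P(3)[OF diff_in_S[OF m1(1) C(3)]] u by metis
  then show False using m1(2) by simp
qed

theorem prox_C1_iff_moreau_C2_iff_rel_interior:
  "((\<exists>\<rho>>0. \<forall>r\<in>{0<..<1 / \<rho>}. set_valued_C1_around (prox r \<phi>) (x0 + r *\<^sub>R adj (D x0) l0)) \<longleftrightarrow>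
    (\<exists>\<rho>>0. \<forall>r\<in>{0<..<1 / \<rho>}. ereal_C2_around (moreau_envelope r \<phi>) (x0 + r *\<^sub>R adj (D x0) l0))) \<and>
   ((\<exists>\<rho>>0. \<forall>r\<in>{0<..<1 / \<rho>}. ereal_C2_around (moreau_envelope r \<phi>) (x0 + r *\<^sub>R adj (D x0) l0)) \<longleftrightarrow>
    adj (D x0) l0 \<in> rel_interior (subdifferential \<phi> x0))"
  (is "(?a \<longleftrightarrow> ?b) \<and> (?b \<longleftrightarrow> ?c)")
proof -
  have "ereal_C2_around (moreau_envelope r \<phi>) y" if "0 < r" "set_valued_C1_around (prox r \<phi>) y" for r y
    using prox_C1_imp_moreau_C2[OF that(1) pb _ that(2), of x0] by (simp add: phi_x0)
  then have "?a \<Longrightarrow> ?b" by fastforce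
  moreover have "?b \<Longrightarrow> ?c"
    using moreau_C2_imp_rel_interior rel_interior_subdifferential_iff by blast
  moreover have "?c \<Longrightarrow> ?a"
    using prox_C1 rel_interior_subdifferential_iff by blast
  ultimately show ?thesis by blast
qed

end

section \<open>Reduction of the matrix formulation to the abstract setting\<close>

lemma inner_transpose_jacobian:
  fixes \<Phi> :: "real^'n \<Rightarrow> real^'m"
  assumes "(\<Phi> has_derivative blinfun_apply X) (at x)"
  shows "transpose (jacobian \<Phi> (at x)) *v l = adj X l"
proof -
  have "(\<Phi> has_derivative (\<lambda>h. jacobian \<Phi> (at x) *v h)) (at x)"
    using assms jacobian_works differentiable_def by blast
  then have "blinfun_apply X = (\<lambda>h. jacobian \<Phi> (at x) *v h)"
    using assms has_derivative_unique by blast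
  then have "(transpose (jacobian \<Phi> (at x)) *v l) \<bullet> h = adj X l \<bullet> h" for h
    by (simp add: inner_adj dot_lmul_matrix flip: vector_transpose_matrix)
  then show ?thesis
    using vector_eq_rdot by blast
qed

theorem theorem4p7:
  fixes \<phi> :: "real^'n \<Rightarrow> ereal"
    and g :: "real^'m \<Rightarrow> ereal"
    and \<Phi> :: "real^'n \<Rightarrow> real^'m"
    and xbar vbar :: "real^'n"
    and lbar :: "real^'m"
  assumes "\<bar>\<phi> xbar\<bar> \<noteq> \<infinity>"
    and "composite_representation \<phi> g \<Phi> xbar"
    and "vbar \<in> subdifferential \<phi> xbar"
    and "multipliers g \<Phi> xbar vbar = {lbar}"
    and "SOQC g \<Phi> xbar lbar"
    and "prox_bounded \<phi>"
  shows "((\<exists>\<rho>>0. \<forall>r\<in>{0<..<1 / \<rho>}. set_valued_C1_around (prox r \<phi>) (xbar + r *\<^sub>R vbar)) \<longleftrightarrow>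
          (\<exists>\<rho>>0. \<forall>r\<in>{0<..<1 / \<rho>}. ereal_C2_around (moreau_envelope r \<phi>) (xbar + r *\<^sub>R vbar))) \<and>
         ((\<exists>\<rho>>0. \<forall>r\<in>{0<..<1 / \<rho>}. ereal_C2_around (moreau_envelope r \<phi>) (xbar + r *\<^sub>R vbar)) \<longleftrightarrow>
          vbar \<in> rel_interior (subdifferential \<phi> xbar))"
proof -
  obtain W D D2 where poly: "polyhedral_fun g" and W: "open W" "xbar \<in> W"
    and D: "\<And>x. x \<in> W \<Longrightarrow> (\<Phi> has_derivative blinfun_apply (D x)) (at x)"
    and D2: "\<And>x. x \<in> W \<Longrightarrow> (D has_derivative blinfun_apply (D2 x)) (at x)" "continuous_on W D2"
    and \<phi>: "\<forall>\<^sub>F y in nhds xbar. \<phi> y = g (\<Phi> y)"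
    using assms(2) unfolding composite_representation_def C2_around_def C2_on_def C1_on_def by blast
  define z where "z = \<Phi> xbar"
  define C where "C = subdifferential g z"
  define S where "S = span ((\<lambda>l. l - lbar) ` C)"
  note transp = inner_transpose_jacobian[OF D[OF W(2)]]
  have "lbar \<in> multipliers g \<Phi> xbar vbar" using assms(4) by blast
  then have l: "lbar \<in> C" and v: "vbar = adj (D xbar) lbar"
    unfolding multipliers_def transp C_def z_def by auto
  define \<gamma> where "\<gamma> = real_of_ereal (g z)"
  have gz: "g z = ereal \<gamma>"
    using l by (simp add: C_def subdifferential_def \<gamma>_def ereal_real)
  have conv: "convex (epi g)"
    using poly by (simp add: polyhedral_fun_def polyhedron_imp_convex)
  obtain \<epsilon> where eps: "\<epsilon> > 0" "\<And>d \<tau>. norm d < \<epsilon> \<Longrightarrow>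
      g (z + d) \<le> ereal (\<gamma> + \<tau>) \<longleftrightarrow> (\<forall>l\<in>C. l \<bullet> d \<le> \<tau>)"
    using polyhedral_local_model[OF poly gz l[unfolded C_def]] unfolding C_def by metis
  have "(\<Phi> \<longlongrightarrow> z) (nhds xbar)"
    using has_derivative_continuous[OF D[OF W(2)]]
    unfolding isCont_def tendsto_at_iff_tendsto_nhds z_def .
  then have "\<forall>\<^sub>F x in nhds xbar. \<Phi> x \<in> ball z \<epsilon>"
    using eps(1) by (intro topological_tendstoD) auto
  moreover have "\<forall>\<^sub>F x in nhds xbar. x \<in> W"
    using W by (rule eventually_nhds_in_open)
  ultimately have "\<forall>\<^sub>F x in nhds xbar. x \<in> W \<and> \<Phi> x \<in> ball z \<epsilon> \<and> \<phi> x = g (\<Phi> x)"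
    using \<phi> by eventually_elim auto
  \<comment> \<open>On \<open>U\<close> the representation holds and \<open>\<Phi>\<close> takes
    values where the polyhedral model of \<open>g\<close> at \<open>z\<close> is valid.\<close>
  then obtain U where U: "open U" "xbar \<in> U"
    "\<And>x. x \<in> U \<Longrightarrow> x \<in> W \<and> \<Phi> x \<in> ball z \<epsilon> \<and> \<phi> x = g (\<Phi> x)"
    by (auto simp: eventually_nhds)
  obtain P where P: "bounded_linear P" "\<And>x. P x \<in> S" "\<And>s x. s \<in> S \<Longrightarrow> s \<bullet> P x = s \<bullet> x"
    "\<And>s. s \<in> S \<Longrightarrow> P s = s"
    using subspace_projection[of S] unfolding S_def by (metis subspace_span)
  interpret nondegenerate_composition \<phi> \<Phi> D D2 U xbar C lbar \<gamma> P S
  proof (rule nondegenerate_composition.intro)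
    show "\<phi> x \<le> ereal (\<gamma> + \<tau>) \<longleftrightarrow> (\<forall>l\<in>C. l \<bullet> (\<Phi> x - \<Phi> xbar) \<le> \<tau>)" if "x \<in> U" for x \<tau>
    proof -
      have "norm (\<Phi> x - z) < \<epsilon>" "\<phi> x = g (\<Phi> x)"
        using U(3)[OF that] by (auto simp: dist_norm norm_minus_commute)
      then show ?thesis
        using eps(2)[of "\<Phi> x - z" \<tau>] by (simp add: z_def)
    qed
    \<comment> \<open>The direction space of \<open>C\<close> lies in the coderivative at 0, so SOQC
      leaves only the zero vector in the kernel of the transposed Jacobian.\<close>
    show "s = 0" if "s \<in> S" "adj (D xbar) s = 0" for s
    proof -
      have "s \<in> coderivative (subdifferential g) (\<Phi> xbar) lbar 0"
        using coderivative_subdifferential_polyhedral[OF poly gz l[unfolded C_def]] that(1)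
        unfolding S_def C_def z_def by blast
      then show ?thesis
        using assms(5) that(2) unfolding SOQC_def transp by auto
    qed
    show "continuous_on U D2"
      using D2(2) U(3) by (auto intro: continuous_on_subset)
  qed (use U D D2 P l closed_subdifferential[OF conv] convex_subdifferential[OF conv] assms(6)
      in \<open>auto simp: C_def S_def\<close>)
  show ?thesis
    unfolding v by (rule prox_C1_iff_moreau_C2_iff_rel_interior)
qed

end
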